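(* Let $S$ be a strictly positive symmetric operator on a complex Hilbert space $\mathcal{H}$, let $A=iS$, and let $S_F$ and $S_K$ denote the (strictly positive, selfadjoint) Friedrichs extension and the Kreĭn–von Neumann extension of $S$, respectively. Let $V_A$ be the nonnegative selfadjoint operator associated to the closure of the quadratic form $q_A(f)=\mathrm{Im}\langle f,Af\rangle$, $\mathcal{D}(q_A)=\mathcal{D}(A)$, and let $W_A$ be the operator with $\mathcal{D}(W_A)=\mathrm{ran}(V_A^{1/2}\upharpoonright_{\mathcal{D}(A)})$ and $W_Ag=AV_A^{-1/2}g$. Then the adjoint $W_A^*$ is given by $$\mathcal{D}(W_A^* )=\mathcal{D}(S_K^{1/2})=\mathcal{D}(S_F^{1/2})\dot{+}\ker(S^* ),\qquad W_A^*f=-iS_F^{1/2}\mathcal{P}f,$$ where $\mathcal{P}$ is the (unbounded) projection onto $\mathcal{D}(S_F^{1/2})$ along $\ker(S^* )$ according to the decomposition $\mathcal{D}(S_K^{1/2})=\mathcal{D}(S_F^{1/2})\dot{+}\ker(S^* )$.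
   Context: Inner products are linear in the second component. A symmetric (in particular densely defined) operator $S$ is strictly positive if there is $\varepsilon>0$ with $\langle f,Sf\rangle\geq\varepsilon\|f\|^2$ for all $f\in\mathcal{D}(S)$. The Kreĭn–von Neumann extension $S_K$ is the nonnegative selfadjoint operator defined by $\mathcal{D}(S_K)=\mathcal{D}(\overline{S})\dot{+}\ker(S^* )$, $S_K=S^*\upharpoonright_{\mathcal{D}(S_K)}$, where $\overline{S}$ is the closure of $S$. $\dot{+}$ denotes an algebraic direct sum and $\upharpoonright$ denotes restriction. For $A=iS$ the form $q_A(f)=\langle f,Sf\rangle$ is closable; its closure $q_A'$ has domain all $f\in\mathcal{H}$ for which there is $\{f_n\}\subset\mathcal{D}(A)$ with $\|f_n-f\|\to0$ and $q_A(f_n-f_m)\to0$ as $n,m\to\infty$, and $q_A'(f)=\lim_n q_A(f_n)$. $V_A$ is the selfadjoint operator representing $q_A'$, i.e. $\mathcal{D}(V_A^{1/2})=\mathcal{D}(q_A')$ and $\|V_A^{1/2}f\|^2=q_A'(f)$. $V_A^{1/2}$ is boundedly invertible and $W_A$ is densely defined. *)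

theory Defs
  imports "HOL-Analysis.Analysis"
begin

text \<open>Complex Hilbert spaces. The inner product is linear in the second component; its real part is
  the inner product of the underlying real Hilbert space, so that norm and topology are those of
  the class \<^class>\<open>real_inner\<close>.\<close>

class chilbert_space = real_inner + complete_space +
  fixes scaleC :: "complex \<Rightarrow> 'a \<Rightarrow> 'a"  (infixr "*\<^sub>C" 75)
    and cinner :: "'a \<Rightarrow> 'a \<Rightarrow> complex"
  assumes scaleC_add_right: "c *\<^sub>C (x + y) = c *\<^sub>C x + c *\<^sub>C y"
    and scaleC_add_left: "(c + d) *\<^sub>C x = c *\<^sub>C x + d *\<^sub>C x"
    and scaleC_scaleC: "c *\<^sub>C d *\<^sub>C x = (c * d) *\<^sub>C x"
    and scaleC_of_real: "of_real r *\<^sub>C x = r *\<^sub>R x"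
    and cinner_commute: "cinner x y = cnj (cinner y x)"
    and cinner_add_right: "cinner x (y + z) = cinner x y + cinner x z"
    and cinner_scaleC_right: "cinner x (c *\<^sub>C y) = c * cinner x y"
    and Re_cinner: "Re (cinner x y) = inner x y"

instantiation complex :: chilbert_space
begin

definition scaleC_complex :: "complex \<Rightarrow> complex \<Rightarrow> complex"
  where "scaleC_complex c x = c * x"

definition cinner_complex :: "complex \<Rightarrow> complex \<Rightarrow> complex"
  where "cinner_complex x y = cnj x * y"

instance
  by standard
    (auto simp: scaleC_complex_def cinner_complex_def algebra_simps scaleR_conv_of_real
      inner_complex_def)

end

text \<open>An unbounded operator is identified with its graph, so that \<^const>\<open>Domain\<close> is its domain,
  inclusion is extension of operators, and the topological closure of the graph is the graph of
  the closure of the operator.\<close>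

type_synonym 'a op = "('a \<times> 'a) set"

definition linear_op :: "'a::chilbert_space op \<Rightarrow> bool" where
  "linear_op T \<longleftrightarrow> single_valued T \<and> (0, 0) \<in> T \<and>
     (\<forall>(f, g)\<in>T. \<forall>(f', g')\<in>T. (f + f', g + g') \<in> T) \<and>
     (\<forall>c. \<forall>(f, g)\<in>T. (c *\<^sub>C f, c *\<^sub>C g) \<in> T)"

definition app :: "'a op \<Rightarrow> 'a \<Rightarrow> 'a" where
  "app T f = (THE g. (f, g) \<in> T)"

definition op_on :: "'a set \<Rightarrow> ('a \<Rightarrow> 'a) \<Rightarrow> 'a op" where
  "op_on D F = {(f, F f) | f. f \<in> D}"

definition op_scale :: "complex \<Rightarrow> 'a::chilbert_space op \<Rightarrow> 'a op" where
  "op_scale c T = {(f, c *\<^sub>C g) | f g. (f, g) \<in> T}"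

definition ker :: "'a::chilbert_space op \<Rightarrow> 'a set" where
  "ker T = {f. (f, 0) \<in> T}"

text \<open>The adjoint relation; it is (the graph of) an operator iff \<open>T\<close> is densely defined.\<close>

definition adj :: "'a::chilbert_space op \<Rightarrow> 'a op" where
  "adj T = {(f, h). \<forall>(u, v)\<in>T. cinner f v = cinner h u}"

definition densely_defined :: "'a::chilbert_space op \<Rightarrow> bool" where
  "densely_defined T \<longleftrightarrow> closure (Domain T) = UNIV"

definition symmetric_op :: "'a::chilbert_space op \<Rightarrow> bool" where
  "symmetric_op T \<longleftrightarrow> linear_op T \<and> densely_defined T \<and> T \<subseteq> adj T"

definition selfadjoint :: "'a::chilbert_space op \<Rightarrow> bool" where
  "selfadjoint T \<longleftrightarrow> linear_op T \<and> densely_defined T \<and> adj T = T"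

text \<open>The following two are only used for symmetric operators, for which \<open>\<langle>f, T f\<rangle>\<close> is real.\<close>

definition nonnegative :: "'a::chilbert_space op \<Rightarrow> bool" where
  "nonnegative T \<longleftrightarrow> (\<forall>(f, g)\<in>T. Re (cinner f g) \<ge> 0)"

definition strictly_positive :: "'a::chilbert_space op \<Rightarrow> bool" where
  "strictly_positive T \<longleftrightarrow> (\<exists>\<epsilon>>0. \<forall>(f, g)\<in>T. Re (cinner f g) \<ge> \<epsilon> * (norm f)\<^sup>2)"

text \<open>The unique nonnegative selfadjoint square root of a nonnegative selfadjoint operator.
  The relational product \<open>B O B\<close> is the operator square of \<open>B\<close> on its natural domain.\<close>

definition op_sqrt :: "'a::chilbert_space op \<Rightarrow> 'a op" where
  "op_sqrt T = (THE B. selfadjoint B \<and> nonnegative B \<and> B O B = T)"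

text \<open>A quadratic form is given by its domain \<open>D\<close> and its values \<open>q\<close> on \<open>D\<close>.\<close>

definition form_approx ::
    "'a::chilbert_space set \<Rightarrow> ('a \<Rightarrow> real) \<Rightarrow> 'a \<Rightarrow> (nat \<Rightarrow> 'a) \<Rightarrow> bool" where
  "form_approx D q f s \<longleftrightarrow> (\<forall>n. s n \<in> D) \<and> (\<lambda>n. norm (s n - f)) \<longlonglongrightarrow> 0 \<and>
     ((\<lambda>(n, m). q (s n - s m)) \<longlongrightarrow> 0) (sequentially \<times>\<^sub>F sequentially)"

definition closure_form_dom :: "'a::chilbert_space set \<Rightarrow> ('a \<Rightarrow> real) \<Rightarrow> 'a set" where
  "closure_form_dom D q = {f. \<exists>s. form_approx D q f s}"

definition closure_form :: "'a::chilbert_space set \<Rightarrow> ('a \<Rightarrow> real) \<Rightarrow> 'a \<Rightarrow> real" where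
  "closure_form D q f = (THE l. \<forall>s. form_approx D q f s \<longrightarrow> (\<lambda>n. q (s n)) \<longlonglongrightarrow> l)"

text \<open>The nonnegative selfadjoint operator representing a closed nonnegative form.\<close>

definition form_op :: "'a::chilbert_space set \<Rightarrow> ('a \<Rightarrow> real) \<Rightarrow> 'a op" where
  "form_op D q = (THE V. selfadjoint V \<and> nonnegative V \<and> Domain (op_sqrt V) = D \<and>
     (\<forall>f\<in>D. (norm (app (op_sqrt V) f))\<^sup>2 = q f))"

definition friedrichs :: "'a::chilbert_space op \<Rightarrow> 'a op" where
  "friedrichs S = (let q = (\<lambda>f. Re (cinner f (app S f))) in
     form_op (closure_form_dom (Domain S) q) (closure_form (Domain S) q))"

text \<open>The sum defining the domain is direct if \<open>S\<close> is strictly positive.\<close>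

definition krein_von_neumann :: "'a::chilbert_space op \<Rightarrow> 'a op" where
  "krein_von_neumann S =
     op_on {u + v | u v. u \<in> Domain (closure S) \<and> v \<in> ker (adj S)} (app (adj S))"

definition V_op :: "'a::chilbert_space op \<Rightarrow> 'a op" where
  "V_op A = (let q = (\<lambda>f. Im (cinner f (app A f))) in
     form_op (closure_form_dom (Domain A) q) (closure_form (Domain A) q))"

text \<open>The operator product of \<open>A\<close> and the inverse of the square root of \<open>V_op A\<close>; its natural
  domain is the image of \<open>Domain A\<close> under that square root.\<close>

definition W_op :: "'a::chilbert_space op \<Rightarrow> 'a op" where
  "W_op A = (op_sqrt (V_op A))\<inverse> O A"

definition is_direct_sum :: "'a::chilbert_space set \<Rightarrow> 'a set \<Rightarrow> 'a set \<Rightarrow> bool" where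
  "is_direct_sum X U N \<longleftrightarrow> X = {u + v | u v. u \<in> U \<and> v \<in> N} \<and> U \<inter> N = {0}"

definition proj_along :: "'a::chilbert_space set \<Rightarrow> 'a set \<Rightarrow> 'a \<Rightarrow> 'a" where
  "proj_along U N f = (THE u. u \<in> U \<and> f - u \<in> N)"

end

theory Submission imports Defs begin

text \<open>
  Write $B = S_F^{1/2}$, which is also $V_A^{1/2}$, since $q_A$ is the form of $S$. A pair $(f, h)$
  lies in the adjoint of $W_A$ iff $\langle f, i S u\rangle = \langle h, B u\rangle$ for all $u$ in the
  domain of $S$. As $B$ is onto, there is a $u_0$ with $B u_0 = i h$, and the condition says that
  $f - u_0$ is orthogonal to the range of $S$, i.e. lies in $\ker S^*$. Up to the factor $-i$ the
  adjoint of $W_A$ is therefore the closed operator $L (u + v) = B u$ on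
  $\mathcal{D}(B) + \ker S^*$. One computes $L^* L = S_K$, and a closed operator $L$ has the same
  domain as $(L^* L)^{1/2}$.
\<close>

section \<open>Minimizing sequences and orthogonal projection\<close>

text \<open>Square roots, \<open>friedrichs\<close> and \<open>V_op\<close> are definite
  descriptions, so existence and uniqueness come before any computation: for roots through the
  bounded resolvent (1 + T)^-1, for form operators through polarization. Nearly everything happens
  in the underlying real Hilbert space; complex linearity is carried by invariance of graphs under
  multiplication by i, which makes the real and the complex adjoint coincide. Strict positivity acts
  in three ways: S_F, hence B, is onto; S_F is injective, so the sum is direct; and the closure of S
  has closed range, the orthogonal complement of ker S^*. The last point explains L^* L = S_K. For h
  = B u, testing L^* h = g on D(B) gives S_F u = g, and testing on ker S^* puts g into the range of
  the closure of S; injectivity of S_F then puts u into the domain of that closure. That L is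
  single-valued rests on D(S) being a core of B.\<close>

instance chilbert_space \<subseteq> banach ..

text \<open>The value at the minimizer -b/c is nonnegative. The degenerate case \<open>c = 0\<close>
  is kept because the forms below need not be definite.\<close>

lemma discriminant_le:
  fixes a b c :: real
  assumes pos: "\<And>t. 0 \<le> a + 2 * b * t + c * t\<^sup>2" and "0 \<le> c"
  shows "b\<^sup>2 \<le> a * c"
proof (cases "c = 0")
  case True
  have "b = 0"
  proof (rule ccontr)
    assume "b \<noteq> 0"
    \<comment> \<open>At this t the remaining affine function takes the value -1.\<close>
    then have "2 * b * (- (a + 1) / (2 * b)) = - (a + 1)" by simp
    then show False using pos[of "- (a + 1) / (2 * b)"] True by simp
  qed
  then show ?thesis using True by simp
next
  case False
  then have c: "c > 0" using \<open>0 \<le> c\<close> by simp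
  have "a + 2 * b * (- b / c) + c * (- b / c)\<^sup>2 = a - b\<^sup>2 / c"
    using c by (simp add: power2_eq_square)
  then have "b\<^sup>2 / c \<le> a" using pos[of "- b / c"] by simp
  then show ?thesis using c by (simp add: pos_divide_le_eq)
qed

text \<open>The product filter matches the double limit in \<open>form_approx\<close>, so that the
  two notions translate into each other literally.\<close>

definition form_Cauchy :: "('c::real_vector \<Rightarrow> 'c \<Rightarrow> real) \<Rightarrow> (nat \<Rightarrow> 'c) \<Rightarrow> bool" where
  "form_Cauchy b s \<longleftrightarrow>
     ((\<lambda>(n, m). b (s n - s m) (s n - s m)) \<longlongrightarrow> 0) (sequentially \<times>\<^sub>F sequentially)"

text \<open>Symmetry and positivity are confined to \<open>D\<close> because the main instance lives
  on pairs (f, g), where <f, g'> is bilinear everywhere but symmetric only along the graph of a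
  symmetric operator.\<close>

locale semi_inner_on =
  fixes D :: "'c::real_vector set" and b :: "'c \<Rightarrow> 'c \<Rightarrow> real"
  assumes subspace_D: "subspace D" and bilinear_b: "bilinear b"
    and sym: "x \<in> D \<Longrightarrow> y \<in> D \<Longrightarrow> b x y = b y x"
    and nonneg: "x \<in> D \<Longrightarrow> 0 \<le> b x x"
begin

lemmas form_simps = bilinear_ladd[OF bilinear_b] bilinear_radd[OF bilinear_b]
  bilinear_lsub[OF bilinear_b] bilinear_rsub[OF bilinear_b]
  bilinear_lmul[OF bilinear_b] bilinear_rmul[OF bilinear_b]

lemma form_add_scale:
  assumes "x \<in> D" "y \<in> D"
  shows "b (x + t *\<^sub>R y) (x + t *\<^sub>R y) = b x x + 2 * b x y * t + b y y * t\<^sup>2"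
  using sym[OF assms] by (simp add: form_simps algebra_simps power2_eq_square)

lemma cauchy_schwarz:
  assumes "x \<in> D" "y \<in> D"
  shows "(b x y)\<^sup>2 \<le> b x x * b y y"
proof (rule discriminant_le)
  fix t
  have "0 \<le> b (x + t *\<^sub>R y) (x + t *\<^sub>R y)"
    using assms subspace_D by (intro nonneg subspace_add subspace_scale)
  then show "0 \<le> b x x + 2 * b x y * t + b y y * t\<^sup>2"
    using form_add_scale[OF assms] by simp
qed (use assms nonneg in auto)

text \<open>A minimizer of b x x - 2 l x would represent \<open>l\<close>. As \<open>D\<close> need
  not be complete under \<open>b\<close>, a minimizing sequence takes its place; each application
  supplies the limit in its own topology.\<close>

lemma riesz_minimizing_sequence:
  assumes l: "linear l" and bound: "\<And>x. x \<in> D \<Longrightarrow> (l x)\<^sup>2 \<le> C * b x x" and C: "0 \<le> C"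
  obtains s where "\<And>n. s n \<in> D" "form_Cauchy b s"
    "\<And>y. y \<in> D \<Longrightarrow> (\<lambda>n. b (s n) y) \<longlonglongrightarrow> l y"
proof -
  define \<phi> where "\<phi> x = b x x - 2 * l x" for x
  \<comment> \<open>By the arithmetic-geometric mean inequality, 2 |l x| is at most 2 sqrt (C * b x
    x), hence at most C + b x x.\<close>
  have lower: "- C \<le> \<phi> x" if "x \<in> D" for x
  proof -
    have "(2 * l x)\<^sup>2 \<le> 4 * (C * b x x)" using bound[OF that] by (simp add: power2_eq_square)
    also have "\<dots> \<le> (C + b x x)\<^sup>2"
      using zero_le_power2[of "C - b x x"] by (simp add: power2_eq_square algebra_simps)
    finally have "2 * l x \<le> C + b x x"
      using C nonneg[OF that] by (meson add_nonneg_nonneg power2_le_imp_le)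
    then show ?thesis by (simp add: \<phi>_def)
  qed
  define m where "m = Inf (\<phi> ` D)"
  have bdd: "bdd_below (\<phi> ` D)" using lower by (auto simp: bdd_below_def)
  have D0: "0 \<in> D" using subspace_D by (rule subspace_0)
  have m_le: "m \<le> \<phi> x" if "x \<in> D" for x
    unfolding m_def using that bdd by (intro cInf_lower) auto
  define e :: "nat \<Rightarrow> real" where "e n = inverse (Suc n)" for n
  have e0: "e \<longlonglongrightarrow> 0" unfolding e_def by (rule LIMSEQ_inverse_real_of_nat)
  have "\<exists>x\<in>D. \<phi> x < m + e n" for n
  proof -
    have "Inf (\<phi> ` D) < m + e n" by (simp add: m_def e_def)
    then show ?thesis using D0 cInf_lessD[of "\<phi> ` D"] by auto
  qed
  then obtain s where sD: "\<And>n. s n \<in> D" and s: "\<And>n. \<phi> (s n) < m + e n" by metis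
  have "form_Cauchy b s"
    unfolding form_Cauchy_def
  proof (rule tendsto_sandwich[where f = "\<lambda>_. 0" and h = "\<lambda>p. 2 * e (fst p) + 2 * e (snd p)"])
    show "\<forall>\<^sub>F p in sequentially \<times>\<^sub>F sequentially.
        (case p of (i, j) \<Rightarrow> b (s i - s j) (s i - s j)) \<le> 2 * e (fst p) + 2 * e (snd p)"
    proof (intro always_eventually allI, clarsimp)
      fix i j
      define x y where "x = s i" and "y = s j"
      have xy: "x \<in> D" "y \<in> D" by (auto simp: x_def y_def sD)
      have "m \<le> \<phi> ((1/2) *\<^sub>R (x + y))"
        using xy subspace_D by (intro m_le subspace_scale subspace_add)
      \<comment> \<open>The parallelogram identity; the linear parts of \<phi> cancel.\<close>
      moreover have "b (x - y) (x - y) = 2 * \<phi> x + 2 * \<phi> y - 4 * \<phi> ((1/2) *\<^sub>R (x + y))"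
        using sym[OF xy]
        by (simp add: \<phi>_def form_simps linear_add[OF l] linear_scale[OF l] field_simps)
      ultimately show "b (s i - s j) (s i - s j) \<le> 2 * e i + 2 * e j"
        using s[of i] s[of j] by (simp add: x_def y_def)
    qed
    show "((\<lambda>p. 2 * e (fst p) + 2 * e (snd p)) \<longlongrightarrow> 0) (sequentially \<times>\<^sub>F sequentially)"
      using tendsto_add[OF tendsto_mult_left[OF filterlim_compose[OF e0 filterlim_fst], of 2]
          tendsto_mult_left[OF filterlim_compose[OF e0 filterlim_snd], of 2]] by simp
    show "\<forall>\<^sub>F p in sequentially \<times>\<^sub>F sequentially. 0 \<le> (case p of (i, j) \<Rightarrow> b (s i - s j) (s i - s j))"
      using sD subspace_D by (auto intro!: always_eventually nonneg subspace_diff)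
  qed (rule tendsto_const)
  moreover have "(\<lambda>n. b (s n) y) \<longlonglongrightarrow> l y" if y: "y \<in> D" for y
  proof -
    \<comment> \<open>Near-minimality of \<open>s n\<close> along the line in direction
      \<open>y\<close> is a nonnegative quadratic in t with constant term
      \<open>e n\<close>.\<close>
    have d: "(b (s n) y - l y)\<^sup>2 \<le> e n * b y y" for n
    proof (rule discriminant_le)
      fix t
      have "m \<le> \<phi> (s n + t *\<^sub>R y)"
        using y sD subspace_D by (intro m_le subspace_add subspace_scale)
      then show "0 \<le> e n + 2 * (b (s n) y - l y) * t + b y y * t\<^sup>2"
        using s[of n] form_add_scale[OF sD y, of n t]
        by (simp add: \<phi>_def linear_add[OF l] linear_scale[OF l] algebra_simps)
    qed (use y nonneg in auto)
    have "(\<lambda>n. (b (s n) y - l y)\<^sup>2) \<longlonglongrightarrow> 0"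
    proof (rule tendsto_sandwich[OF _ _ tendsto_const])
      show "(\<lambda>n. e n * b y y) \<longlonglongrightarrow> 0" using tendsto_mult_right[OF e0] by simp
    qed (use d in auto)
    then have "(\<lambda>n. b (s n) y - l y) \<longlonglongrightarrow> 0"
      using tendsto_real_sqrt[of "\<lambda>n. (b (s n) y - l y)\<^sup>2" 0 sequentially]
      by (simp add: tendsto_rabs_zero_iff)
    then show ?thesis by (rule LIM_zero_cancel)
  qed
  ultimately show thesis using that sD by blast
qed

end

lemma tendsto_prod_sequentially_zero_iff:
  fixes g :: "nat \<Rightarrow> nat \<Rightarrow> real"
  shows "((\<lambda>(n, m). g n m) \<longlongrightarrow> 0) (sequentially \<times>\<^sub>F sequentially) \<longleftrightarrow>
    (\<forall>e>0. \<exists>N. \<forall>n\<ge>N. \<forall>m\<ge>N. \<bar>g n m\<bar> < e)"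
  unfolding tendsto_iff eventually_prod_sequentially by (simp add: dist_real_def) blast

lemma Cauchy_iff_norm_power2:
  fixes f :: "nat \<Rightarrow> 'b::real_normed_vector"
  shows "Cauchy f \<longleftrightarrow>
    ((\<lambda>(n, m). (norm (f n - f m))\<^sup>2) \<longlongrightarrow> 0) (sequentially \<times>\<^sub>F sequentially)"
proof
  assume f: "Cauchy f"
  show "((\<lambda>(n, m). (norm (f n - f m))\<^sup>2) \<longlongrightarrow> 0) (sequentially \<times>\<^sub>F sequentially)"
    unfolding tendsto_prod_sequentially_zero_iff
  proof safe
    fix e :: real assume "e > 0"
    then obtain N where "\<forall>m\<ge>N. \<forall>n\<ge>N. norm (f m - f n) < sqrt e"
      using CauchyD[OF f, of "sqrt e"] by auto
    then have "\<forall>m\<ge>N. \<forall>n\<ge>N. \<bar>(norm (f m - f n))\<^sup>2\<bar> < e"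
      using \<open>e > 0\<close> by (metis abs_norm_cancel abs_power2 real_less_rsqrt real_sqrt_abs real_sqrt_less_iff)
    then show "\<exists>N. \<forall>n\<ge>N. \<forall>m\<ge>N. \<bar>(norm (f n - f m))\<^sup>2\<bar> < e" by blast
  qed
next
  assume f: "((\<lambda>(n, m). (norm (f n - f m))\<^sup>2) \<longlongrightarrow> 0) (sequentially \<times>\<^sub>F sequentially)"
  show "Cauchy f"
  proof (rule CauchyI)
    fix e :: real assume "e > 0"
    then obtain N where "\<forall>n\<ge>N. \<forall>m\<ge>N. \<bar>(norm (f n - f m))\<^sup>2\<bar> < e\<^sup>2"
      using f unfolding tendsto_prod_sequentially_zero_iff by (meson zero_less_power)
    then show "\<exists>M. \<forall>m\<ge>M. \<forall>n\<ge>M. norm (f m - f n) < e"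
      using \<open>e > 0\<close> by (metis abs_power2 power_less_imp_less_base order_less_imp_le)
  qed
qed

lemma subspace_closure_normed:
  fixes M :: "'b::real_normed_vector set"
  assumes "subspace M"
  shows "subspace (closure M)"
  unfolding subspace_def
proof safe
  show "0 \<in> closure M" using assms subspace_0 closure_subset by blast
next
  fix x y assume "x \<in> closure M" "y \<in> closure M"
  then obtain f g where "\<forall>n. f n \<in> M" "f \<longlonglongrightarrow> x" "\<forall>n. g n \<in> M" "g \<longlonglongrightarrow> y"
    unfolding closure_sequential by blast
  then show "x + y \<in> closure M"
    unfolding closure_sequential using assms
    by (intro exI[of _ "\<lambda>n. f n + g n"]) (auto intro: subspace_add tendsto_add)
next
  fix c x assume "x \<in> closure M"
  then obtain f where "\<forall>n. f n \<in> M" "f \<longlonglongrightarrow> x"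
    unfolding closure_sequential by blast
  then show "c *\<^sub>R x \<in> closure M"
    unfolding closure_sequential using assms
    by (intro exI[of _ "\<lambda>n. c *\<^sub>R f n"]) (auto intro: subspace_scale tendsto_scaleR)
qed

text \<open>The projection represents the functional \<open>inner x\<close> on \<open>M\<close>:
  with \<open>inner\<close> as form, form-Cauchy means Cauchy in norm, so the minimizing sequence
  converges inside \<open>M\<close>.\<close>

lemma orthogonal_projection:
  fixes M :: "'b::{real_inner,banach} set"
  assumes M: "subspace M" "closed M"
  obtains m where "m \<in> M" "\<And>y. y \<in> M \<Longrightarrow> inner (x - m) y = 0"
proof -
  interpret semi_inner_on M "inner"
    using M by unfold_locales (auto simp: inner_commute bilinear_def intro!: bounded_linear.linear bounded_linear_inner_left bounded_linear_inner_right)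
  have "(inner x y)\<^sup>2 \<le> inner x x * inner y y" for y by (rule Cauchy_Schwarz_ineq)
  then obtain s where s: "\<And>n. s n \<in> M" "form_Cauchy inner s"
      "\<And>y. y \<in> M \<Longrightarrow> (\<lambda>n. inner (s n) y) \<longlonglongrightarrow> inner x y"
    using riesz_minimizing_sequence[of "inner x" "inner x x"]
    by (metis bounded_linear.linear bounded_linear_inner_right inner_ge_zero)
  have "Cauchy s"
    using s(2) unfolding form_Cauchy_def Cauchy_iff_norm_power2 power2_norm_eq_inner .
  then obtain m where m: "s \<longlonglongrightarrow> m" using Cauchy_convergent convergent_def by blast
  have "inner (x - m) y = 0" if "y \<in> M" for y
    using LIMSEQ_unique[OF s(3)[OF that] tendsto_inner[OF m tendsto_const[of y]]]
    by (simp add: inner_diff_left)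
  moreover have "m \<in> M" using M(2) s(1) m closed_sequentially by blast
  ultimately show thesis using that by blast
qed

text \<open>With m the projection of x onto the closure, x - m is itself an admissible y, which
  forces x = m. All density claims below reduce to this.\<close>

lemma mem_closure_if_double_orthogonal:
  fixes M :: "'b::{real_inner,banach} set"
  assumes M: "subspace M" and x: "\<And>y. (\<And>m. m \<in> M \<Longrightarrow> inner m y = 0) \<Longrightarrow> inner x y = 0"
  shows "x \<in> closure M"
proof -
  obtain m where m: "m \<in> closure M" "\<And>y. y \<in> closure M \<Longrightarrow> inner (x - m) y = 0"
    using orthogonal_projection[of "closure M" x] M by (metis closed_closure subspace_closure_normed)
  have "inner x (x - m) = 0"
    using m(2)[OF subsetD[OF closure_subset]] by (intro x) (simp add: inner_commute)
  moreover have "inner (x - m) m = 0" using m by blast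
  ultimately have "inner (x - m) (x - m) = 0" by (simp add: inner_diff_right inner_diff_left inner_commute)
  then show ?thesis using m(1) by simp
qed

section \<open>Square roots of bounded positive operators\<close>

text \<open>Symmetry is a separate clause because over the reals a nonnegative quadratic form does
  not force it.\<close>

definition positive_blinfun :: "('a::real_inner \<Rightarrow>\<^sub>L 'a) \<Rightarrow> bool" where
  "positive_blinfun R \<longleftrightarrow>
     (\<forall>x y. inner (R x) y = inner x (R y)) \<and> (\<forall>x. 0 \<le> inner x (R x))"

lemma positive_blinfunD:
  assumes "positive_blinfun R"
  shows "inner (R x) y = inner x (R y)" "0 \<le> inner x (R x)"
  using assms by (auto simp: positive_blinfun_def)

lemma semi_inner_on_positive_blinfun:
  assumes "positive_blinfun R"
  shows "semi_inner_on UNIV (\<lambda>x y. inner x (R y))"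
proof
  show "bilinear (\<lambda>x y. inner x (R y))"
    by (auto simp: bilinear_def blinfun.bilinear_simps inner_add inner_left_distrib inner_right_distrib
      intro!: linearI)
  show "inner x (R y) = inner y (R x)" for x y
    using positive_blinfunD(1)[OF assms, of y x] by (simp add: inner_commute)
qed (use assms in \<open>auto simp: positive_blinfun_def\<close>)

lemma positive_blinfun_Cauchy_Schwarz:
  assumes "positive_blinfun R"
  shows "(inner x (R y))\<^sup>2 \<le> inner x (R x) * inner y (R y)"
  using semi_inner_on.cauchy_schwarz[OF semi_inner_on_positive_blinfun[OF assms]] by simp

lemma positive_blinfun_eq_0:
  assumes "positive_blinfun R" "inner x (R x) = 0"
  shows "R x = 0"
  using positive_blinfun_Cauchy_Schwarz[OF assms(1), of "R x" x] assms(2) by simp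

text \<open>Cauchy-Schwarz for the form of \<open>X\<close>, applied to X x and x, bounds the fourth
  power of the norm of X x; one factor (norm (X x))^2 cancels.\<close>

lemma positive_blinfun_norm_le:
  assumes "positive_blinfun X" and le: "\<And>x. inner x (X x) \<le> (norm x)\<^sup>2"
  shows "norm X \<le> 1"
proof (rule norm_blinfun_bound)
  fix x
  have "((norm (X x))\<^sup>2)\<^sup>2 \<le> inner (X x) (X (X x)) * inner x (X x)"
    using positive_blinfun_Cauchy_Schwarz[OF assms(1), of "X x" x] by (simp add: power2_norm_eq_inner)
  also have "\<dots> \<le> (norm (X x))\<^sup>2 * (norm x)\<^sup>2"
    using positive_blinfunD(2)[OF assms(1)] by (intro mult_mono le) auto
  finally have le: "(norm (X x))\<^sup>2 * (norm (X x))\<^sup>2 \<le> (norm (X x))\<^sup>2 * (norm x)\<^sup>2"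
    unfolding power2_eq_square .
  have "(norm (X x))\<^sup>2 \<le> (norm x)\<^sup>2"
  proof (cases "X x = 0")
    case False
    then show ?thesis by (intro mult_left_le_imp_le[OF le]) simp
  qed simp
  then have "norm (X x) \<le> norm x" by (rule power2_le_imp_le) simp
  then show "norm (X x) \<le> 1 * norm x" by simp
qed simp

lemma inner_contraction_le:
  fixes L :: "'a::real_inner \<Rightarrow>\<^sub>L 'a"
  assumes "norm L \<le> 1"
  shows "inner x (L x) \<le> inner x x"
proof -
  have "norm (L x) \<le> norm x"
    using norm_blinfun[of L x] mult_right_mono[OF assms norm_ge_zero[of x]] by simp
  then show ?thesis
    using norm_cauchy_schwarz[of x "L x"] mult_left_mono[OF _ norm_ge_zero[of x], of "norm (L x)" "norm x"]
    by (simp add: dot_square_norm power2_eq_square)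
qed

text \<open>The root is $1 - L$ for the limit $L$ of $Y_{n+1} = (X + Y_n^2) / 2$ with $X = 1 - R$. The norms of
  the differences $Y_{n+1} - Y_n$ are dominated by those of the scalar iteration \<open>y\<close> for
  $X = 1$, which telescope.\<close>

lemma positive_blinfun_sqrt_contraction:
  fixes R :: "'a::{real_inner,banach} \<Rightarrow>\<^sub>L 'a"
  assumes R: "positive_blinfun R" and "norm R \<le> 1"
  obtains C where "positive_blinfun C" "C o\<^sub>L C = R"
    "\<And>Z. Z o\<^sub>L R = R o\<^sub>L Z \<Longrightarrow> Z o\<^sub>L C = C o\<^sub>L Z"
proof -
  define X where "X = id_blinfun - R"
  have "positive_blinfun X"
    unfolding positive_blinfun_def
  proof safe
    fix x show "0 \<le> inner x (X x)"
      using inner_contraction_le[OF \<open>norm R \<le> 1\<close>, of x]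
      by (simp add: X_def blinfun.bilinear_simps inner_diff_right)
  qed (simp add: X_def blinfun.bilinear_simps inner_diff positive_blinfunD(1)[OF R])
  moreover have "inner x (X x) \<le> (norm x)\<^sup>2" for x
    using positive_blinfunD(2)[OF R]
    by (simp add: X_def blinfun.bilinear_simps inner_diff_right power2_norm_eq_inner)
  ultimately have normX: "norm X \<le> 1" by (rule positive_blinfun_norm_le)
  define Y where "Y = rec_nat 0 (\<lambda>_ Z. (1/2) *\<^sub>R (X + (Z o\<^sub>L Z)))"
  have Y0: "Y 0 = 0" and YS: "Y (Suc n) = (1/2) *\<^sub>R (X + (Y n o\<^sub>L Y n))" for n
    by (simp_all add: Y_def)
  define y :: "nat \<Rightarrow> real" where "y = rec_nat 0 (\<lambda>_ z. (1/2) * (1 + z * z))"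
  have y0: "y 0 = 0" and yS: "y (Suc n) = (1/2) * (1 + y n * y n)" for n
    by (simp_all add: y_def)
  have y01: "0 \<le> y n \<and> y n \<le> 1" for n
  proof (induction n)
    case (Suc n)
    then have "y n * y n \<le> 1 * 1" by (intro mult_mono) auto
    then show ?case by (simp add: yS)
  qed (simp add: y0)
  have y_le: "y n \<le> y (Suc n)" for n
    using zero_le_power2[of "y n - 1"] by (simp add: yS power2_eq_square algebra_simps)
  have "incseq y" using y_le by (rule incseq_SucI)
  then obtain ly where "y \<longlonglongrightarrow> ly"
    using y01 by (metis incseq_convergent)
  then have "summable (\<lambda>n. y (Suc n) - y n)" by (rule telescope_summable)
  have normY: "norm (Y n) \<le> y n" for n
  proof (induction n)
    case (Suc n)
    have "norm (Y n o\<^sub>L Y n) \<le> y n * y n"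
      using Suc norm_blinfun_compose[of "Y n" "Y n"] y01[of n]
      by (meson mult_mono norm_ge_zero order_trans)
    then show ?case
      using norm_triangle_ineq[of X "(Y n o\<^sub>L Y n)"] normX by (simp add: YS yS)
  qed (simp add: Y0 y0)
  \<comment> \<open>Every iterate is a polynomial in X.\<close>
  have commute: "Z o\<^sub>L Y n = Y n o\<^sub>L Z" if "Z o\<^sub>L X = X o\<^sub>L Z" for Z n
  proof (induction n)
    case (Suc n)
    have ZX: "Z (X v) = X (Z v)" for v using that by (metis blinfun_apply_blinfun_compose)
    have ZY: "Z (Y n v) = Y n (Z v)" for v using Suc by (metis blinfun_apply_blinfun_compose)
    show ?case by (rule blinfun_eqI) (simp add: YS blinfun.bilinear_simps ZX ZY)
  qed (simp add: Y0)
  have diff: "norm (Y (Suc n) - Y n) \<le> y (Suc n) - y n" for n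
  proof (induction n)
    case (Suc n)
    define A B where "A = Y (Suc n)" and "B = Y n"
    \<comment> \<open>Commuting iterates permit the factorization A^2 - B^2 = (A - B)(A +
      B).\<close>
    have AB: "A (B v) = B (A v)" for v
      using commute[OF commute[of X n, symmetric], of "Suc n"] unfolding A_def B_def
      by (metis blinfun_apply_blinfun_compose)
    have "Y (Suc (Suc n)) - Y (Suc n) = (1/2) *\<^sub>R (A o\<^sub>L A) - (1/2) *\<^sub>R (B o\<^sub>L B)"
      unfolding A_def B_def YS[of "Suc n"] by (subst (3) YS) (simp add: scaleR_add_right)
    also have "\<dots> = (1/2) *\<^sub>R ((A - B) o\<^sub>L (A + B))"
      by (intro blinfun_eqI)
        (simp add: blinfun.add_left blinfun.diff_left blinfun.add_right blinfun.scaleR_left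
          scaleR_add_right scaleR_diff_right AB)
    finally have "Y (Suc (Suc n)) - Y (Suc n) = (1/2) *\<^sub>R ((Y (Suc n) - Y n) o\<^sub>L (Y (Suc n) + Y n))"
      unfolding A_def B_def .
    moreover have "norm ((Y (Suc n) - Y n) o\<^sub>L (Y (Suc n) + Y n)) \<le> (y (Suc n) - y n) * (y (Suc n) + y n)"
    proof -
      have "norm (Y (Suc n) + Y n) \<le> y (Suc n) + y n"
        using norm_triangle_ineq[of "Y (Suc n)" "Y n"] normY[of n] normY[of "Suc n"] by linarith
      then show ?thesis
        using Suc y_le[of n] norm_blinfun_compose[of "Y (Suc n) - Y n" "Y (Suc n) + Y n"]
        by (meson diff_ge_0_iff_ge mult_mono norm_ge_zero order_trans)
    qed
    moreover have "y (Suc (Suc n)) - y (Suc n) = (1/2) * ((y (Suc n) - y n) * (y (Suc n) + y n))"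
      by (simp add: yS[of "Suc n"] yS[of n] algebra_simps)
    ultimately show ?case by simp
  qed (use normY[of "Suc 0"] in \<open>simp add: Y0 y0\<close>)
  have "summable (\<lambda>n. Y (Suc n) - Y n)"
    by (rule summable_comparison_test'[OF \<open>summable (\<lambda>n. y (Suc n) - y n)\<close>, of 0]) (rule diff)
  then have "(\<lambda>n. \<Sum>i<n. Y (Suc i) - Y i) \<longlonglongrightarrow> (\<Sum>n. Y (Suc n) - Y n)"
    by (rule summable_LIMSEQ)
  then obtain L where L: "Y \<longlonglongrightarrow> L"
    by (simp add: sum_lessThan_telescope Y0)
  have "(\<lambda>n. (1/2) *\<^sub>R (X + (Y n o\<^sub>L Y n))) \<longlonglongrightarrow> (1/2) *\<^sub>R (X + (L o\<^sub>L L))"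
    by (intro tendsto_intros L bounded_bilinear.tendsto[OF bounded_bilinear_blinfun_compose])
  then have "(1/2) *\<^sub>R (X + (L o\<^sub>L L)) = L"
    using LIMSEQ_Suc[OF L] LIMSEQ_unique unfolding YS by blast
  then have "blinfun_apply ((1/2) *\<^sub>R (X + (L o\<^sub>L L))) v = L v" for v by simp
  then have half: "(1/2) *\<^sub>R (X v + L (L v)) = L v" for v
    by (simp only: blinfun.bilinear_simps blinfun_apply_blinfun_compose)
  \<comment> \<open>The limit solves 2 L = X + L^2, that is, (1 - L)^2 = 1 - X = R.\<close>
  have LL: "L (L v) = 2 *\<^sub>R L v - X v" for v
  proof -
    have "X v + L (L v) = 2 *\<^sub>R (1/2) *\<^sub>R (X v + L (L v))" by simp
    then show ?thesis unfolding half by (metis add_diff_cancel_left')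
  qed
  have symY: "inner (Y n v) w = inner v (Y n w)" for n v w
  proof (induction n arbitrary: v w)
    case (Suc n)
    show ?case
      using positive_blinfunD(1)[OF \<open>positive_blinfun X\<close>]
      by (simp add: YS blinfun.bilinear_simps inner_add Suc)
  qed (simp add: Y0)
  have symL: "inner (L v) w = inner v (L w)" for v w
  proof (rule LIMSEQ_unique)
    show "(\<lambda>n. inner (Y n v) w) \<longlonglongrightarrow> inner (L v) w" by (intro tendsto_intros L)
    show "(\<lambda>n. inner (Y n v) w) \<longlonglongrightarrow> inner v (L w)"
      unfolding symY by (intro tendsto_intros L)
  qed
  have "norm L \<le> 1"
    using normY y01 by (intro LIMSEQ_le_const2[OF tendsto_norm[OF L]]) (meson order_trans)
  define C where "C = id_blinfun - L"
  show thesis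
  proof
    show "positive_blinfun C"
      unfolding positive_blinfun_def
    proof safe
      fix x show "0 \<le> inner x (C x)"
        using inner_contraction_le[OF \<open>norm L \<le> 1\<close>, of x]
        by (simp add: C_def blinfun.bilinear_simps inner_diff_right)
    qed (simp add: C_def blinfun.bilinear_simps inner_diff symL)
    show "C o\<^sub>L C = R"
      by (rule blinfun_eqI) (simp add: C_def blinfun.bilinear_simps LL, simp add: X_def blinfun.bilinear_simps
          scaleR_2)
  next
    fix Z assume "Z o\<^sub>L R = R o\<^sub>L Z"
    then have "Z (R v) = R (Z v)" for v by (metis blinfun_apply_blinfun_compose)
    then have "Z o\<^sub>L X = X o\<^sub>L Z" by (intro blinfun_eqI) (simp add: X_def blinfun.bilinear_simps)
    then have ZY: "Z (Y n v) = Y n (Z v)" for n v using commute by (metis blinfun_apply_blinfun_compose)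
    have "Z (L v) = L (Z v)" for v
    proof (rule LIMSEQ_unique)
      show "(\<lambda>n. Z (Y n v)) \<longlonglongrightarrow> Z (L v)" by (intro tendsto_intros L)
      show "(\<lambda>n. Z (Y n v)) \<longlonglongrightarrow> L (Z v)" unfolding ZY by (intro tendsto_intros L)
    qed
    then show "Z o\<^sub>L C = C o\<^sub>L Z" by (intro blinfun_eqI) (simp add: C_def blinfun.bilinear_simps)
  qed
qed

lemma positive_blinfun_scaleR:
  "positive_blinfun R \<Longrightarrow> 0 \<le> c \<Longrightarrow> positive_blinfun (c *\<^sub>R R)"
  by (simp add: positive_blinfun_def blinfun.bilinear_simps)

lemma positive_blinfun_sqrt:
  fixes R :: "'a::{real_inner,banach} \<Rightarrow>\<^sub>L 'a"
  assumes R: "positive_blinfun R"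
  obtains C where "positive_blinfun C" "C o\<^sub>L C = R"
    "\<And>Z. Z o\<^sub>L R = R o\<^sub>L Z \<Longrightarrow> Z o\<^sub>L C = C o\<^sub>L Z"
proof -
  \<comment> \<open>Rescaling makes R a contraction; the summand 1 keeps k positive when R =
    0.\<close>
  define k where "k = norm R + 1"
  have k: "k > 0" by (simp add: k_def add_nonneg_pos)
  have "positive_blinfun ((1/k) *\<^sub>R R)" using R k by (intro positive_blinfun_scaleR) auto
  moreover have "norm ((1/k) *\<^sub>R R) \<le> 1" using k by (simp add: k_def)
  ultimately obtain C where C: "positive_blinfun C" "C o\<^sub>L C = (1/k) *\<^sub>R R"
    "\<And>Z. Z o\<^sub>L ((1/k) *\<^sub>R R) = ((1/k) *\<^sub>R R) o\<^sub>L Z \<Longrightarrow> Z o\<^sub>L C = C o\<^sub>L Z"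
    using positive_blinfun_sqrt_contraction by blast
  show thesis
  proof
    show "positive_blinfun (sqrt k *\<^sub>R C)" using C(1) k by (intro positive_blinfun_scaleR) auto
    have CC: "C (C v) = (1/k) *\<^sub>R R v" for v
      using C(2) by (metis blinfun.scaleR_left blinfun_apply_blinfun_compose)
    show "(sqrt k *\<^sub>R C) o\<^sub>L (sqrt k *\<^sub>R C) = R"
      using k by (intro blinfun_eqI) (simp add: blinfun.bilinear_simps CC)
  next
    fix Z assume Z: "Z o\<^sub>L R = R o\<^sub>L Z"
    have ZR: "Z (R v) = R (Z v)" for v using Z by (metis blinfun_apply_blinfun_compose)
    have "Z o\<^sub>L C = C o\<^sub>L Z"
      by (intro C(3) blinfun_eqI) (simp add: blinfun.bilinear_simps ZR)
    then have ZC: "Z (C v) = C (Z v)" for v by (metis blinfun_apply_blinfun_compose)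
    show "Z o\<^sub>L (sqrt k *\<^sub>R C) = (sqrt k *\<^sub>R C) o\<^sub>L Z"
      by (intro blinfun_eqI) (simp add: blinfun.bilinear_simps ZC)
  qed
qed

text \<open>Since a root $C$ of $A$ commutes with $B$, the form of $A B$ at $x$ is that of $B$ at $C x$.\<close>

lemma positive_blinfun_compose:
  fixes A :: "'a::{real_inner,banach} \<Rightarrow>\<^sub>L 'a"
  assumes A: "positive_blinfun A" and B: "positive_blinfun B" and AB: "A o\<^sub>L B = B o\<^sub>L A"
  shows "positive_blinfun (A o\<^sub>L B)"
proof -
  obtain C where C: "positive_blinfun C" "C o\<^sub>L C = A"
    and comm: "\<And>Z. Z o\<^sub>L A = A o\<^sub>L Z \<Longrightarrow> Z o\<^sub>L C = C o\<^sub>L Z"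
    using positive_blinfun_sqrt[OF A] by blast
  have BC: "B (C v) = C (B v)" for v
    using comm[OF AB[symmetric]] by (metis blinfun_apply_blinfun_compose)
  have BA: "B (A v) = A (B v)" for v
    using AB by (metis blinfun_apply_blinfun_compose)
  have "inner x (A (B x)) = inner (C x) (B (C x))" for x
    using positive_blinfunD(1)[OF C(1)] C(2) BC by (metis blinfun_apply_blinfun_compose)
  then show ?thesis
    using positive_blinfunD[OF A] positive_blinfunD[OF B] BA
    by (simp add: positive_blinfun_def)
qed

text \<open>Every root Z commutes with its square, hence with the constructed root C. For y = C x -
  Z x this gives (C + Z) y = 0, so both nonnegative forms vanish at y, C y = Z y = 0, and <y, y> =
  <x, (C - Z) y> = 0.\<close>

lemma positive_blinfun_sqrt_unique:
  fixes P Q :: "'a::{real_inner,banach} \<Rightarrow>\<^sub>L 'a"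
  assumes P: "positive_blinfun P" and Q: "positive_blinfun Q" and PQ: "P o\<^sub>L P = Q o\<^sub>L Q"
  shows "P = Q"
proof -
  obtain C where C: "positive_blinfun C" "C o\<^sub>L C = P o\<^sub>L P"
    and comm: "\<And>Z. Z o\<^sub>L (P o\<^sub>L P) = (P o\<^sub>L P) o\<^sub>L Z \<Longrightarrow> Z o\<^sub>L C = C o\<^sub>L Z"
    using positive_blinfun_sqrt[of "P o\<^sub>L P"] positive_blinfun_compose[OF P P] by blast
  have "C = Z" if Z: "positive_blinfun Z" "Z o\<^sub>L Z = P o\<^sub>L P" for Z
  proof (rule blinfun_eqI)
    fix x
    have "Z o\<^sub>L C = C o\<^sub>L Z" by (intro comm blinfun_eqI) (simp flip: Z(2))
    then have ZC: "Z (C v) = C (Z v)" for v by (metis blinfun_apply_blinfun_compose)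
    have sq: "C (C v) = Z (Z v)" for v using C(2) Z(2) by (metis blinfun_apply_blinfun_compose)
    define y where "y = C x - Z x"
    have "C y + Z y = 0" by (simp add: y_def blinfun.bilinear_simps ZC sq)
    then have "inner y (C y) + inner y (Z y) = 0" by (metis inner_right_distrib inner_zero_right)
    then have "inner y (C y) = 0" "inner y (Z y) = 0"
      using positive_blinfunD(2)[OF C(1), of y] positive_blinfunD(2)[OF Z(1), of y] by linarith+
    then have "C y = 0" "Z y = 0"
      using positive_blinfun_eq_0 C(1) Z(1) by blast+
    then have "inner y y = 0"
      using positive_blinfunD(1)[OF C(1), of x y] positive_blinfunD(1)[OF Z(1), of x y]
      by (simp add: y_def inner_diff_left)
    then show "C x = Z x" by (simp add: y_def)
  qed
  then show ?thesis using P Q PQ by metis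
qed

section \<open>Nonnegative selfadjoint graphs\<close>

text \<open>The adjoint for the real inner product. Being an annihilator condition, it is a closed
  subspace for any relation \<open>T\<close>.\<close>

definition radj :: "('a::real_inner \<times> 'a) set \<Rightarrow> ('a \<times> 'a) set" where
  "radj T = {(f, h). \<forall>(u, v)\<in>T. inner f v = inner h u}"

lemma radjI: "(\<And>u v. (u, v) \<in> T \<Longrightarrow> inner f v = inner h u) \<Longrightarrow> (f, h) \<in> radj T"
  by (auto simp: radj_def)

lemma radjD: "(f, h) \<in> radj T \<Longrightarrow> (u, v) \<in> T \<Longrightarrow> inner f v = inner h u"
  by (auto simp: radj_def)

lemma subspace_radj: "subspace (radj T)"
  by (auto simp: subspace_def radj_def zero_prod_def inner_add_left split_beta)

lemma closed_radj: "closed (radj T)"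
proof -
  have "radj T = (\<Inter>(u, v)\<in>T. {p. inner (fst p) v = inner (snd p) u})"
    by (auto simp: radj_def)
  moreover have "closed {p. inner (fst p) v = inner (snd p) u}" for u v :: 'a
    by (intro closed_Collect_eq continuous_intros)
  ultimately show ?thesis by auto
qed

lemma subspace_prod_add:
  "subspace T \<Longrightarrow> (f, g) \<in> T \<Longrightarrow> (f', g') \<in> T \<Longrightarrow> (f + f', g + g') \<in> T"
  using subspace_add[of T "(f, g)" "(f', g')"] by simp

lemma subspace_prod_diff:
  "subspace T \<Longrightarrow> (f, g) \<in> T \<Longrightarrow> (f', g') \<in> T \<Longrightarrow> (f - f', g - g') \<in> T"
  using subspace_diff[of T "(f, g)" "(f', g')"] by simp

lemma subspace_prod_scale:
  "subspace T \<Longrightarrow> (f, g) \<in> T \<Longrightarrow> (c *\<^sub>R f, c *\<^sub>R g) \<in> T"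
  using subspace_scale[of T "(f, g)" c] by simp

lemma subspace_prod_0: "subspace T \<Longrightarrow> (0, 0) \<in> T"
  using subspace_0[of T] by (simp add: zero_prod_def)

lemma closed_prod_limit:
  assumes "closed T" "\<And>n. (f n, g n) \<in> T" "f \<longlonglongrightarrow> a" "g \<longlonglongrightarrow> b"
  shows "(a, b) \<in> T"
  using closed_sequentially[OF assms(1), of "\<lambda>n. (f n, g n)"] tendsto_Pair[OF assms(3,4)] assms(2) by blast

text \<open>Linearity and closedness are inherited from \<open>radj T = T\<close>, and density of
  the domain from the single-valuedness of \<open>radj T\<close>.\<close>

definition nonneg_sa :: "('a::real_inner \<times> 'a) set \<Rightarrow> bool" where
  "nonneg_sa T \<longleftrightarrow> single_valued T \<and> radj T = T \<and> (\<forall>(f, g)\<in>T. 0 \<le> inner f g)"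

lemma nonneg_saD:
  assumes "nonneg_sa T"
  shows "single_valued T" "radj T = T" "subspace T" "closed T"
    "(f, g) \<in> T \<Longrightarrow> 0 \<le> inner f g"
    "(f, g) \<in> T \<Longrightarrow> (u, v) \<in> T \<Longrightarrow> inner f v = inner g u"
proof -
  show "single_valued T" and T: "radj T = T" and "(f, g) \<in> T \<Longrightarrow> 0 \<le> inner f g"
    using assms by (auto simp: nonneg_sa_def)
  show "subspace T" "closed T" using subspace_radj[of T] closed_radj[of T] by (simp_all add: T)
  show "(f, g) \<in> T \<Longrightarrow> (u, v) \<in> T \<Longrightarrow> inner f v = inner g u"
    using radjD[of f g T u v] by (simp add: T)
qed

text \<open>Given (f, h) in the adjoint, some point of \<open>T\<close> has the same sum of
  components. The difference is a pair (d, -d) in the adjoint, which says that d is orthogonal to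
  the range of 1 + T.\<close>

lemma radj_eqI_add:
  assumes sym: "\<And>f g u v. (f, g) \<in> T \<Longrightarrow> (u, v) \<in> T \<Longrightarrow> inner f v = inner g u"
    and surj: "\<And>x. \<exists>f g. (f, g) \<in> T \<and> f + g = x"
  shows "radj T = T"
proof safe
  fix f h assume fh: "(f, h) \<in> radj T"
  obtain u v where uv: "(u, v) \<in> T" "u + v = f + h" using surj by blast
  have "(u, v) \<in> radj T" using sym[OF uv(1)] by (intro radjI)
  then have "(f - u, h - v) \<in> radj T" using fh subspace_radj subspace_prod_diff by blast
  moreover have "h - v = - (f - u)" using uv(2) by (simp add: algebra_simps)
  ultimately have "inner (f - u) (a + b) = 0" if "(a, b) \<in> T" for a b
    using radjD[OF _ that] by (metis add.commute add.right_inverse inner_minus_left inner_right_distrib)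
  then have "inner (f - u) (f - u) = 0" using surj[of "f - u"] by metis
  then have "f = u" by simp
  then show "(f, h) \<in> T" using uv by simp
qed (use sym in \<open>auto intro: radjI\<close>)

text \<open>The same argument with the range of \<open>T\<close> in place of that of 1 + T; it
  serves the Friedrichs extension, whose range is everything by strict positivity.\<close>

lemma radj_eqI_surj:
  assumes sym: "\<And>f g u v. (f, g) \<in> T \<Longrightarrow> (u, v) \<in> T \<Longrightarrow> inner f v = inner g u"
    and surj: "\<And>x. \<exists>f. (f, x) \<in> T"
  shows "radj T = T"
proof safe
  fix f h assume fh: "(f, h) \<in> radj T"
  obtain u where u: "(u, h) \<in> T" using surj by blast
  have "(u, h) \<in> radj T" using sym[OF u] by (intro radjI)
  then have "(f - u, 0) \<in> radj T" using fh subspace_radj subspace_prod_diff by fastforce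
  then have "inner (f - u) b = 0" if "(a, b) \<in> T" for a b
    using radjD[OF _ that] by fastforce
  then have "inner (f - u) (f - u) = 0" using surj[of "f - u"] by metis
  then show "(f, h) \<in> T" using u by simp
qed (use sym in \<open>auto intro: radjI\<close>)

lemma bounded_graph_blinfun:
  fixes G :: "('a::real_normed_vector \<times> 'b::real_normed_vector) set"
  assumes G: "subspace G" and total: "\<And>x. \<exists>y. (x, y) \<in> G"
    and bound: "\<And>x y. (x, y) \<in> G \<Longrightarrow> norm y \<le> K * norm x"
  obtains A :: "'a \<Rightarrow>\<^sub>L 'b" where "\<And>x y. (x, y) \<in> G \<longleftrightarrow> y = A x"
proof -
  have uniq: "y = y'" if "(x, y) \<in> G" "(x, y') \<in> G" for x y y'
    using bound[OF subspace_prod_diff[OF G that]] by simp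
  obtain a where a: "\<And>x. (x, a x) \<in> G" using total by metis
  have "bounded_linear a"
  proof (rule bounded_linear_intro)
    show "a (x + y) = a x + a y" for x y by (rule uniq[OF a subspace_prod_add[OF G a a]])
    show "a (r *\<^sub>R x) = r *\<^sub>R a x" for r x by (rule uniq[OF a subspace_prod_scale[OF G a]])
    show "norm (a x) \<le> norm x * K" for x using bound[OF a] by (simp add: mult.commute)
  qed
  then have "blinfun_apply (Blinfun a) = a" by (rule bounded_linear_Blinfun_apply)
  then show thesis using that[of "Blinfun a"] a uniq by metis
qed

text \<open>Nonnegativity bounds f and g by f + g, so the range of 1 + T is closed. A vector d
  orthogonal to it gives (d, -d) in \<open>radj T\<close>, which is T, and nonnegativity leaves only
  d = 0.\<close>

lemma nonneg_sa_add_surj: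
  fixes T :: "('a::{real_inner,banach} \<times> 'a) set"
  assumes T: "nonneg_sa T"
  obtains f g where "(f, g) \<in> T" "f + g = x"
proof -
  define M where "M = (\<lambda>(f, g). f + g) ` T"
  have lower: "(norm f)\<^sup>2 \<le> (norm (f + g))\<^sup>2" "(norm g)\<^sup>2 \<le> (norm (f + g))\<^sup>2" if "(f, g) \<in> T" for f g
    using nonneg_saD(5)[OF T that] by (auto simp: power2_norm_eq_inner inner_add inner_commute)
  have "linear (\<lambda>(f, g). f + g :: 'a)"
    by (auto intro!: linearI simp: scaleR_add_right)
  then have "subspace M"
    unfolding M_def using nonneg_saD(3)[OF T] by (rule linear_subspace_image)
  have "closed M"
    unfolding closed_sequential_limits
  proof safe
    fix x l assume x: "\<forall>n. x n \<in> M" and l: "x \<longlonglongrightarrow> l"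
    then have "\<forall>n. \<exists>f g. (f, g) \<in> T \<and> x n = f + g" by (fastforce simp: M_def)
    then obtain f g where fg: "\<And>n. (f n, g n) \<in> T" "\<And>n. x n = f n + g n" by metis
    have c: "Cauchy x" using l by (rule LIMSEQ_imp_Cauchy)
    have "norm (f n - f m) \<le> norm (x n - x m)" "norm (g n - g m) \<le> norm (x n - x m)" for n m
      using lower[OF subspace_prod_diff[OF nonneg_saD(3)[OF T] fg(1)[of n] fg(1)[of m]]]
      by (auto simp: fg(2) algebra_simps intro: power2_le_imp_le)
    then have "Cauchy f" "Cauchy g"
      using c unfolding Cauchy_iff by (meson order_le_less_trans)+
    then obtain a b where "f \<longlonglongrightarrow> a" "g \<longlonglongrightarrow> b"
      using Cauchy_convergent convergent_def by metis
    moreover from this have "(a, b) \<in> T" using closed_prod_limit[OF nonneg_saD(4)[OF T]] fg(1) by blast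
    moreover have "l = a + b"
      using LIMSEQ_unique[OF l] tendsto_add[OF \<open>f \<longlonglongrightarrow> a\<close> \<open>g \<longlonglongrightarrow> b\<close>] fg(2) by presburger
    ultimately show "l \<in> M" by (auto simp: M_def)
  qed
  obtain m where m: "m \<in> M" "\<And>y. y \<in> M \<Longrightarrow> inner (x - m) y = 0"
    using orthogonal_projection[OF \<open>subspace M\<close> \<open>closed M\<close>] by blast
  have "(x - m, - (x - m)) \<in> radj T"
  proof (rule radjI)
    fix u v assume "(u, v) \<in> T"
    then have "u + v \<in> M" by (force simp: M_def)
    then show "inner (x - m) v = inner (- (x - m)) u"
      using m(2)[of "u + v"] unfolding inner_right_distrib inner_minus_left by linarith
  qed
  then have "0 \<le> inner (x - m) (- (x - m))" using nonneg_saD(2,5)[OF T] by metis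
  then have "inner (x - m) (x - m) \<le> 0" unfolding inner_minus_right by linarith
  then have "inner (x - m) (x - m) = 0" using inner_ge_zero[of "x - m"] by linarith
  then have "x = m" by simp
  then show thesis using m(1) that by (auto simp: M_def)
qed

text \<open>\<open>R\<close> is (1 + T)^-1, which sends f + g to f. It encodes \<open>T\<close>
  completely, so questions about the unbounded operator become questions about commuting bounded
  ones.\<close>

lemma nonneg_sa_resolvent:
  fixes T :: "('a::{real_inner,banach} \<times> 'a) set"
  assumes T: "nonneg_sa T"
  obtains R where "positive_blinfun R" "positive_blinfun (id_blinfun - R)"
    "T = {(f, g). f = R (f + g)}"
proof -
  define G where "G = {(x, f). (f, x - f) \<in> T}"
  note sub = nonneg_saD(3)[OF T] and sym = nonneg_saD(6)[OF T] and pos = nonneg_saD(5)[OF T]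
  have "subspace G"
    unfolding subspace_def
  proof safe
    show "0 \<in> G" using subspace_prod_0[OF sub] by (simp add: G_def zero_prod_def)
  next
    fix a b a' b' assume "(a, b) \<in> G" "(a', b') \<in> G"
    then show "(a, b) + (a', b') \<in> G"
      using subspace_prod_add[OF sub, of b "a - b" b' "a' - b'"] by (simp add: G_def algebra_simps)
  next
    fix a b c assume "(a, b) \<in> G"
    then show "c *\<^sub>R (a, b) \<in> G"
      using subspace_prod_scale[OF sub, of b "a - b"] by (simp add: G_def scaleR_diff_right)
  qed
  moreover have "\<exists>f. (x, f) \<in> G" for x
  proof -
    obtain f g where "(f, g) \<in> T" "f + g = x" by (rule nonneg_sa_add_surj[OF T])
    then show ?thesis by (auto simp: G_def intro!: exI[of _ f])
  qed
  moreover have "norm f \<le> 1 * norm x" if "(x, f) \<in> G" for x f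
  proof -
    have "0 \<le> inner f (x - f)" using pos that by (simp add: G_def)
    then have "(norm f)\<^sup>2 \<le> norm f * norm x"
      using norm_cauchy_schwarz[of f x] by (simp add: inner_diff_right power2_norm_eq_inner)
    then show ?thesis by (cases "f = 0") (auto simp: power2_eq_square)
  qed
  ultimately obtain R :: "'a \<Rightarrow>\<^sub>L 'a" where R: "\<And>x f. (x, f) \<in> G \<longleftrightarrow> f = R x"
    using bounded_graph_blinfun by blast
  have RT: "(R x, x - R x) \<in> T" for x using R by (auto simp: G_def)
  have symR: "inner (R x) y = inner x (R y)" for x y
    using sym[OF RT[of x] RT[of y]] by (simp add: inner_diff)
  have posR: "0 \<le> inner (R x) (x - R x)" for x using pos[OF RT] .
  show thesis
  proof
    have "0 \<le> inner x (R x)" for x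
    proof -
      have "inner (R x) (R x) \<le> inner x (R x)"
        using posR[of x] by (simp add: inner_diff_right symR)
      then show ?thesis using inner_ge_zero[of "R x"] by (rule order_trans[rotated])
    qed
    then show "positive_blinfun R" using symR by (simp add: positive_blinfun_def)
    have "0 \<le> inner x (x - R x)" for x
      using posR[of x] inner_ge_zero[of "x - R x"] unfolding inner_diff by (simp add: inner_commute)
    then show "positive_blinfun (id_blinfun - R)"
      using symR by (simp add: positive_blinfun_def blinfun.bilinear_simps inner_diff)
    have "(f, g) \<in> T \<longleftrightarrow> f = R (f + g)" for f g
      using R[of "f + g" f] by (simp add: G_def)
    then show "T = {(f, g). f = R (f + g)}" by auto
  qed
qed

text \<open>With $R = (1 + T)^{-1}$, the root of $T$ is $(1 - R)^{1/2} R^{-1/2}$; its graph is parametrized by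
  the commuting bounded roots $C = R^{1/2}$ and $D = (1 - R)^{1/2}$, which satisfy $C^2 + D^2 = 1$.\<close>

lemma nonneg_sa_sqrt_exists:
  fixes T :: "('a::{real_inner,banach} \<times> 'a) set"
  assumes T: "nonneg_sa T"
  obtains B where "nonneg_sa B" "B O B = T"
    "\<forall>Z :: 'a \<Rightarrow>\<^sub>L 'a. (\<forall>(f, g)\<in>T. (Z f, Z g) \<in> T) \<longrightarrow> (\<forall>(f, g)\<in>B. (Z f, Z g) \<in> B)"
proof -
  obtain R where R: "positive_blinfun R" "positive_blinfun (id_blinfun - R)"
    and T_eq: "T = {(f, g). f = R (f + g)}"
    using nonneg_sa_resolvent[OF T] by blast
  have TR: "(f, g) \<in> T \<longleftrightarrow> f = R (f + g)" for f g by (simp add: T_eq)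
  obtain C where C: "positive_blinfun C" and CC': "C o\<^sub>L C = R"
    and commC: "\<And>Z. Z o\<^sub>L R = R o\<^sub>L Z \<Longrightarrow> Z o\<^sub>L C = C o\<^sub>L Z"
    using positive_blinfun_sqrt[OF R(1)] by blast
  obtain D where D: "positive_blinfun D" and DD': "D o\<^sub>L D = id_blinfun - R"
    and commD: "\<And>Z. Z o\<^sub>L (id_blinfun - R) = (id_blinfun - R) o\<^sub>L Z \<Longrightarrow> Z o\<^sub>L D = D o\<^sub>L Z"
    using positive_blinfun_sqrt[OF R(2)] by blast
  have CC: "C (C v) = R v" for v using CC' by (metis blinfun_apply_blinfun_compose)
  have DD: "D (D v) = v - R v" for v
    using arg_cong[OF DD', of "\<lambda>A. blinfun_apply A v"] by (simp add: blinfun.bilinear_simps)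
  have sumCD: "C (C v) + D (D v) = v" for v by (simp add: CC DD)
  have commCZ: "C (Z v) = Z (C v)" "D (Z v) = Z (D v)" if "\<And>v. Z (R v) = R (Z v)"
    for Z :: "'a \<Rightarrow>\<^sub>L 'a" and v
  proof -
    have "Z o\<^sub>L C = C o\<^sub>L Z" by (intro commC blinfun_eqI) (simp add: that)
    then show "C (Z v) = Z (C v)" by (metis blinfun_apply_blinfun_compose)
    have "Z o\<^sub>L D = D o\<^sub>L Z" by (intro commD blinfun_eqI) (simp add: that blinfun.bilinear_simps)
    then show "D (Z v) = Z (D v)" by (metis blinfun_apply_blinfun_compose)
  qed
  have CR: "C (R v) = R (C v)" for v by (metis CC)
  have DC: "D (C v) = C (D v)" for v using commCZ(2)[of C] CR by blast
  define B where "B = {(C x, D x) | x. True}"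
  show thesis
  proof
    show "nonneg_sa B"
      unfolding nonneg_sa_def
    proof safe
      show "single_valued B"
      proof (rule single_valuedI)
        fix a b c assume "(a, b) \<in> B" "(a, c) \<in> B"
        then obtain x y where xy: "a = C x" "b = D x" "a = C y" "c = D y" unfolding B_def by blast
        then have "R (x - y) = 0" by (simp add: blinfun.bilinear_simps flip: CC)
        then have "(0, x - y) \<in> T" by (simp add: TR)
        moreover have "(0, 0) \<in> T" by (simp add: TR)
        ultimately have "x - y = 0" using nonneg_saD(1)[OF T] by (meson single_valuedD)
        then show "b = c" using xy by simp
      qed
    next
      fix f h assume fh: "(f, h) \<in> radj B"
      \<comment> \<open>As C and D are symmetric, membership in the adjoint is this single equation;
        C^2 + D^2 = 1 then exhibits C f + D h as the parameter of (f, h).\<close>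
      have eq: "D f = C h"
      proof -
        have "inner f (D x) = inner h (C x)" for x
          using radjD[OF fh] by (auto simp: B_def)
        then have "inner (D f - C h) x = 0" for x
          by (simp add: inner_diff_left positive_blinfunD(1)[OF C] positive_blinfunD(1)[OF D])
        then have "inner (D f - C h) (D f - C h) = 0" by blast
        then show ?thesis by simp
      qed
      have "f = C (C f + D h)"
        using sumCD[of f] by (simp add: blinfun.bilinear_simps eq DC)
      moreover have "h = D (C f + D h)"
        using sumCD[of h] by (simp add: blinfun.bilinear_simps eq DC flip: eq)
      ultimately show "(f, h) \<in> B" unfolding B_def by blast
    next
      fix f h assume "(f, h) \<in> B"
      then obtain x where x: "f = C x" "h = D x" by (auto simp: B_def)
      show "(f, h) \<in> radj B"
        by (rule radjI) (auto simp: B_def x positive_blinfunD(1)[OF C] positive_blinfunD(1)[OF D] DC)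
      have "positive_blinfun (C o\<^sub>L D)"
        using C D by (rule positive_blinfun_compose) (intro blinfun_eqI, simp add: DC)
      then show "0 \<le> inner f h"
        using positive_blinfunD(2)[of "C o\<^sub>L D" x] by (simp add: x positive_blinfunD(1)[OF C])
    qed
    show "B O B = T"
    proof safe
      fix f g h assume "(f, g) \<in> B" "(g, h) \<in> B"
      then obtain x y where xy: "f = C x" "g = D x" "g = C y" "h = D y" by (auto simp: B_def)
      \<comment> \<open>From D x = C y one gets x = C z and y = D z with z = C x + D y, so f = C^2 z
        = R z and h = D^2 z = z - R z.\<close>
      have x: "x = C (C x + D y)"
        using sumCD[of x] xy by (simp add: blinfun.bilinear_simps DC flip: DC)
      have y: "y = D (C x + D y)"
        using sumCD[of y] xy by (simp add: blinfun.bilinear_simps DC)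
      define z where "z = C x + D y"
      have "f = R z" "h = z - R z" using x y xy by (simp_all add: z_def flip: CC DD)
      then show "(f, h) \<in> T" by (simp add: TR)
    next
      fix f h assume "(f, h) \<in> T"
      define z where "z = f + h"
      have "f = R z" using \<open>(f, h) \<in> T\<close> by (simp add: TR z_def)
      moreover from this have "h = z - R z" by (simp add: z_def)
      ultimately have "f = C (C z)" "h = D (D z)" by (simp_all add: CC DD)
      then have "(f, D (C z)) \<in> B" "(D (C z), h) \<in> B" by (auto simp: B_def DC)
      then show "(f, h) \<in> B O B" by blast
    qed
  next
    show "\<forall>Z :: 'a \<Rightarrow>\<^sub>L 'a. (\<forall>(f, g)\<in>T. (Z f, Z g) \<in> T) \<longrightarrow> (\<forall>(f, g)\<in>B. (Z f, Z g) \<in> B)"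
    proof (intro allI impI ballI, clarify)
      \<comment> \<open>An operator that leaves T invariant commutes with R, hence with C and D.
        Taking multiplication by i for Z will make the root complex linear.\<close>
      fix Z :: "'a \<Rightarrow>\<^sub>L 'a" and f g
      assume Z: "\<forall>(f, g)\<in>T. (Z f, Z g) \<in> T" and "(f, g) \<in> B"
      then obtain x where x: "f = C x" "g = D x" by (auto simp: B_def)
      have "Z (R v) = R (Z v)" for v
      proof -
        have "(R v, v - R v) \<in> T" by (simp add: TR)
        then have "(Z (R v), Z (v - R v)) \<in> T" using Z by blast
        then show ?thesis by (simp add: TR blinfun.bilinear_simps)
    qed
    from commCZ[OF this] show "(Z f, Z g) \<in> B" by (auto simp: B_def x intro: exI[of _ "Z x"])
    qed
  qed
qed

text \<open>For any nonnegative selfadjoint root $B$ of $T$ the operator $E = B R$ is bounded and positive, and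
  $E^2 = R - R^2$ does not depend on $B$; hence neither do $E$ and $B$.\<close>

lemma nonneg_sa_sqrt_resolvent:
  fixes T B :: "('a::{real_inner,banach} \<times> 'a) set"
  assumes B: "nonneg_sa B" "B O B = T" and T_eq: "T = {(f, g). f = blinfun_apply R (f + g)}"
  obtains E where "positive_blinfun E" "E o\<^sub>L E = R - (R o\<^sub>L R)" "B = {(f, h). R h = E f}"
proof -
  have TR: "(f, g) \<in> T \<longleftrightarrow> f = R (f + g)" for f g by (simp add: T_eq)
  note sub = nonneg_saD(3)[OF B(1)] and sym = nonneg_saD(6)[OF B(1)] and pos = nonneg_saD(5)[OF B(1)]
  note sv = single_valuedD[OF nonneg_saD(1)[OF B(1)]]
  have RT: "(R x, x - R x) \<in> T" for x by (simp add: TR)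
  \<comment> \<open>The pair (R x, x - R x) lies in T = B^2; k is the intermediate vector B (R
    x).\<close>
  define G where "G = {(x, k). (R x, k) \<in> B \<and> (k, x - R x) \<in> B}"
  have "subspace G"
    unfolding subspace_def
  proof safe
    show "0 \<in> G" using subspace_prod_0[OF sub] by (simp add: G_def zero_prod_def)
  next
    fix a b a' b' assume "(a, b) \<in> G" "(a', b') \<in> G"
    then show "(a, b) + (a', b') \<in> G"
      using subspace_prod_add[OF sub, of b "a - R a" b' "a' - R a'"]
        subspace_prod_add[OF sub, of "R a" b "R a'" b']
      by (simp add: G_def algebra_simps blinfun.bilinear_simps)
  next
    fix a b c assume "(a, b) \<in> G"
    then show "c *\<^sub>R (a, b) \<in> G"
      using subspace_prod_scale[OF sub, of b "a - R a"] subspace_prod_scale[OF sub, of "R a" b]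
      by (simp add: G_def scaleR_diff_right blinfun.bilinear_simps)
  qed
  moreover have "\<exists>k. (x, k) \<in> G" for x
    using RT[of x] by (auto simp: G_def simp flip: B(2))
  moreover have "norm k \<le> 1 * norm x" if "(x, k) \<in> G" for x k
  proof -
    have "inner k k = inner (R x) (x - R x)" using sym[of "R x" k k "x - R x"] that by (simp add: G_def)
    moreover have "2 * inner (R x) (x - R x) \<le> inner x x"
    proof -
      \<comment> \<open>Here p = <x, R x>, q = <R x, R x> and r = <x, x>; the second premise is the
        squared norm of x - R x.\<close>
      have "2 * (p - q) \<le> r" if "0 \<le> q" "0 \<le> r - p - (p - q)" for p q r :: real
        using that by simp
      then show ?thesis
        using inner_ge_zero[of "R x"] inner_ge_zero[of "x - R x"]
        unfolding inner_diff inner_commute[of "R x" x] .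
    qed
    ultimately have "(norm k)\<^sup>2 \<le> (norm x)\<^sup>2"
      using inner_ge_zero[of k] by (simp add: power2_norm_eq_inner)
    then show ?thesis by (simp add: power2_le_iff_abs_le)
  qed
  ultimately obtain E :: "'a \<Rightarrow>\<^sub>L 'a" where E: "\<And>x k. (x, k) \<in> G \<longleftrightarrow> k = E x"
    using bounded_graph_blinfun by blast
  have E1: "(R x, E x) \<in> B" and E2: "(E x, x - R x) \<in> B" for x using E[of x "E x"] by (auto simp: G_def)
  \<comment> \<open>Subtracting (R f, E f) from (f, h) leaves a point of B that continues (E f, f -
    R f), so (E f, h - E f) lies in T.\<close>
  have R_eq: "R h = E f" if "(f, h) \<in> B" for f h
  proof -
    have "(f - R f, h - E f) \<in> B" using subspace_prod_diff[OF sub that E1] .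
    then have "(E f, h - E f) \<in> T" using E2 B(2) by blast
    then show ?thesis by (simp add: TR)
  qed
  show thesis
  proof
    show "positive_blinfun E"
      unfolding positive_blinfun_def
    proof safe
      fix x y
      have "inner (E x) (R y) = inner (R x) (E y)" using sym[OF E1 E1] by metis
      moreover have "inner (E x) (y - R y) = inner (x - R x) (E y)" using sym[OF E2 E2] .
      ultimately show "inner (E x) y = inner x (E y)" by (simp add: inner_diff)
    next
      fix x
      have "0 \<le> inner (R x) (E x)" "0 \<le> inner (E x) (x - R x)" using pos[OF E1] pos[OF E2] by auto
      then show "0 \<le> inner x (E x)" by (simp add: inner_diff inner_commute)
    qed
    have "E (E x) = R x - R (R x)" for x
      using sv[OF E1[of "E x"]] E2[of "R x"] R_eq[OF E1[of x]] by simp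
    then show "E o\<^sub>L E = R - (R o\<^sub>L R)" by (intro blinfun_eqI) (simp add: blinfun.bilinear_simps)
    have "(f, h) \<in> B \<longleftrightarrow> R h = E f" for f h
    proof
      assume "R h = E f"
      then have "(E f, h - E f) \<in> B O B" using B(2) by (simp add: TR)
      then obtain k where "(E f, k) \<in> B" "(k, h - E f) \<in> B" by blast
      moreover from this have "k = f - R f" using sv E2 by blast
      ultimately show "(f, h) \<in> B" using subspace_prod_add[OF sub, of "f - R f" "h - E f" "R f" "E f"] E1 by simp
    qed (rule R_eq)
    then show "B = {(f, h). R h = E f}" by auto
  qed
qed

lemma nonneg_sa_sqrt_unique:
  fixes B B' :: "('a::{real_inner,banach} \<times> 'a) set"
  assumes "nonneg_sa T" "nonneg_sa B" "B O B = T" "nonneg_sa B'" "B' O B' = T"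
  shows "B = B'"
proof -
  obtain R where R: "T = {(f, g). f = blinfun_apply R (f + g)}"
    using nonneg_sa_resolvent[OF assms(1)] by blast
  obtain E where E: "positive_blinfun E" "E o\<^sub>L E = R - (R o\<^sub>L R)" "B = {(f, h). R h = E f}"
    using nonneg_sa_sqrt_resolvent[OF assms(2,3) R] by blast
  obtain E' where E': "positive_blinfun E'" "E' o\<^sub>L E' = R - (R o\<^sub>L R)" "B' = {(f, h). R h = E' f}"
    using nonneg_sa_sqrt_resolvent[OF assms(4,5) R] by blast
  have "E = E'" using positive_blinfun_sqrt_unique[OF E(1) E'(1)] E(2) E'(2) by simp
  then show ?thesis using E(3) E'(3) by simp
qed

section \<open>Von Neumann's theorem on L^* L\<close>

lemma von_Neumann_add_surj:
  fixes L :: "('a::{real_inner,banach} \<times> 'a) set"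
  assumes "subspace L" "closed L"
  obtains f h g where "(f, h) \<in> L" "(h, g) \<in> radj L" "f + g = x"
proof -
  \<comment> \<open>Projecting (x, 0) onto the closed graph leaves the residual (x - f, -h); its
    orthogonality to L is exactly the adjoint relation between h and x - f.\<close>
  obtain p where p: "p \<in> L" "\<And>q. q \<in> L \<Longrightarrow> inner ((x, 0) - p) q = 0"
    using orthogonal_projection[OF assms] by blast
  obtain f h where fh: "p = (f, h)" by (cases p)
  have "(h, x - f) \<in> radj L"
    using p(2) by (intro radjI) (fastforce simp: fh inner_prod_def)
  then show thesis using p(1) that[of f h "x - f"] by (simp add: fh)
qed

text \<open>The relational product applies \<open>L\<close> first, so this is L^* L. Its form is <h,
  h> with h = L f, and the range criterion for 1 + L^* L gives selfadjointness.\<close>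

lemma nonneg_sa_von_Neumann:
  fixes L :: "('a::{real_inner,banach} \<times> 'a) set"
  assumes L: "subspace L" "closed L" "single_valued L"
    and dense: "\<And>w. (\<And>u. u \<in> Domain L \<Longrightarrow> inner w u = 0) \<Longrightarrow> w = 0"
  shows "nonneg_sa (L O radj L)"
  unfolding nonneg_sa_def
proof (intro conjI)
  show "single_valued (L O radj L)"
  proof (rule single_valuedI, clarify)
    fix f g g' h h' assume h: "(f, h) \<in> L" "(f, h') \<in> L" "(h, g) \<in> radj L" "(h', g') \<in> radj L"
    then have "h = h'" using L(3) by (meson single_valuedD)
    then have "inner (g - g') u = 0" if "u \<in> Domain L" for u
      using that radjD[OF h(3)] radjD[OF h(4)] by (auto simp: inner_diff_left)
    then show "g = g'" using dense[of "g - g'"] by simp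
  qed
  show "radj (L O radj L) = L O radj L"
  proof (rule radj_eqI_add, clarify)
    fix f g u v h k assume "(f, h) \<in> L" "(h, g) \<in> radj L" "(u, k) \<in> L" "(k, v) \<in> radj L"
    then show "inner f v = inner g u" by (metis inner_commute radjD)
  next
    show "\<exists>f g. (f, g) \<in> L O radj L \<and> f + g = x" for x
      using von_Neumann_add_surj[OF L(1,2), of x] by blast
  qed
  show "\<forall>(f, g)\<in>L O radj L. 0 \<le> inner f g"
  proof clarify
    fix f h g assume "(f, h) \<in> L" "(h, g) \<in> radj L"
    then have "inner f g = inner h h" by (metis inner_commute radjD)
    then show "0 \<le> inner f g" by simp
  qed
qed

text \<open>Let r = (a, b) in \<open>L\<close> be orthogonal to the restricted graph and write a = f
  + L^* L f. Pairing r with (f, L f) yields <a, a> = 0, so r = 0 because \<open>L\<close> is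
  single-valued.\<close>

lemma von_Neumann_core:
  fixes L :: "('a::{real_inner,banach} \<times> 'a) set"
  assumes L: "subspace L" "closed L" "single_valued L" and p: "p \<in> L"
  shows "p \<in> closure {(f, h). (f, h) \<in> L \<and> f \<in> Domain (L O radj L)}" (is "p \<in> closure ?M")
proof (rule mem_closure_if_double_orthogonal)
  have M: "?M = {(f, h). (f, h) \<in> L \<and> h \<in> Domain (radj L)}"
    using single_valuedD[OF L(3)] by blast
  have "?M = L \<inter> snd -` (fst ` radj L)" unfolding M by force
  then show "subspace ?M"
    using L(1) by (auto intro!: subspace_inter linear_subspace_vimage linear_subspace_image
        linear_fst linear_snd subspace_radj)
  fix q assume q: "\<And>m. m \<in> ?M \<Longrightarrow> inner m q = 0"
  obtain r where r: "r \<in> L" "\<And>y. y \<in> L \<Longrightarrow> inner (q - r) y = 0"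
    using orthogonal_projection[OF L(1,2)] by blast
  obtain a b where ab: "r = (a, b)" by (cases r)
  obtain f h g where f: "(f, h) \<in> L" "(h, g) \<in> radj L" "f + g = a"
    using von_Neumann_add_surj[OF L(1,2)] by blast
  have "inner (f, h) q = 0" using f by (intro q) blast
  then have "inner (f, h) r = 0" using r(2)[OF f(1)] by (simp add: inner_diff_left inner_commute)
  then have "inner (f + g) a = 0" using radjD[OF f(2), of a b] r(1) by (simp add: ab inner_left_distrib)
  then have "a = 0" using f(3) by simp
  then have "r = 0"
    using r(1) single_valuedD[OF L(3)] subspace_prod_0[OF L(1)] by (auto simp: ab zero_prod_def)
  then show "inner p q = 0" using r(2)[OF p] by (simp add: inner_commute)
qed

text \<open>The common square has a domain that is a core of both operators, and their norms agree there.\<close>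

lemma von_Neumann_Domain_subset:
  fixes L L' :: "('a::{real_inner,banach} \<times> 'a) set"
  assumes L: "subspace L" "closed L" "single_valued L" and L': "subspace L'" "closed L'" "single_valued L'"
    and eq: "L O radj L = L' O radj L'"
  shows "Domain L \<subseteq> Domain L'"
proof
  fix f assume "f \<in> Domain L"
  then obtain h where "(f, h) \<in> L" by blast
  from von_Neumann_core[OF L this] obtain p where
    p: "\<And>n. p n \<in> {(f, h). (f, h) \<in> L \<and> f \<in> Domain (L O radj L)}" "p \<longlonglongrightarrow> (f, h)"
    unfolding closure_sequential by auto
  define u v where "u n = fst (p n)" and "v n = snd (p n)" for n
  have uv: "(u n, v n) \<in> L" "u n \<in> Domain (L O radj L)" for n
    using p(1)[of n] by (auto simp: u_def v_def split: prod.splits)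
  have lim: "u \<longlonglongrightarrow> f" "v \<longlonglongrightarrow> h"
    using tendsto_fst[OF p(2)] tendsto_snd[OF p(2)] by (simp_all add: u_def[abs_def] v_def[abs_def])
  have "\<exists>k g. (u n, k) \<in> L' \<and> (k, g) \<in> radj L' \<and> (v n, g) \<in> radj L" for n
  proof -
    obtain g where g: "(u n, g) \<in> L O radj L" using uv(2)[of n] by (rule DomainE)
    then have "(v n, g) \<in> radj L" using uv(1)[of n] single_valuedD[OF L(3)] by blast
    moreover obtain k where "(u n, k) \<in> L'" "(k, g) \<in> radj L'" using g unfolding eq by (rule relcompEpair)
    ultimately show ?thesis by blast
  qed
  then obtain k g where k: "\<And>n. (u n, k n) \<in> L'" "\<And>n. (k n, g n) \<in> radj L'"
    and v: "\<And>n. (v n, g n) \<in> radj L" by metis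
  have "norm (k n - k m) = norm (v n - v m)" for n m
  proof -
    have "inner (k n - k m) (k n - k m) = inner (g n - g m) (u n - u m)"
      using radjD[OF subspace_prod_diff[OF subspace_radj k(2)[of n] k(2)[of m]] subspace_prod_diff[OF L'(1) k(1)[of n] k(1)[of m]]] .
    moreover have "inner (v n - v m) (v n - v m) = inner (g n - g m) (u n - u m)"
      using radjD[OF subspace_prod_diff[OF subspace_radj v[of n] v[of m]] subspace_prod_diff[OF L(1) uv(1)[of n] uv(1)[of m]]] .
    ultimately show ?thesis by (simp add: norm_eq_sqrt_inner)
  qed
  then have "Cauchy k" using LIMSEQ_imp_Cauchy[OF lim(2)] by (simp add: Cauchy_iff)
  then obtain l where "k \<longlonglongrightarrow> l" using Cauchy_convergent convergent_def by blast
  then have "(f, l) \<in> L'" using closed_prod_limit[OF L'(2) k(1) lim(1)] by blast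
  then show "f \<in> Domain L'" by blast
qed

section \<open>Friedrichs and Krein--von Neumann extensions\<close>

text \<open>Placing the form on points of the graph makes it bilinear on the whole product space;
  along the graph of S it is <f, S f'>.\<close>

definition graph_form :: "'a::real_inner \<times> 'a \<Rightarrow> 'a \<times> 'a \<Rightarrow> real" where
  "graph_form p q = inner (fst p) (snd q)"

locale strictly_positive_graph =
  fixes S :: "('a::{real_inner,banach} \<times> 'a) set" and \<epsilon> :: real
  assumes subspace_S: "subspace S"
    and dense_S: "\<And>w. (\<And>u. u \<in> Domain S \<Longrightarrow> inner w u = 0) \<Longrightarrow> w = 0"
    and sym_S: "\<And>f g u v. (f, g) \<in> S \<Longrightarrow> (u, v) \<in> S \<Longrightarrow> inner f v = inner g u"
    and \<epsilon>: "0 < \<epsilon>" and pos_S: "\<And>f g. (f, g) \<in> S \<Longrightarrow> \<epsilon> * (norm f)\<^sup>2 \<le> inner f g"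
begin

lemma single_valued_S: "single_valued S"
proof (rule single_valuedI)
  fix f g g' assume g: "(f, g) \<in> S" "(f, g') \<in> S"
  have "inner (g - g') u = 0" if "u \<in> Domain S" for u
    using that sym_S[OF g(1)] sym_S[OF g(2)] by (auto simp: inner_diff_left)
  then show "g = g'" using dense_S[of "g - g'"] by simp
qed

sublocale semi_inner_on S graph_form
proof
  show "subspace S" by (rule subspace_S)
  show "bilinear (graph_form :: 'a \<times> 'a \<Rightarrow> 'a \<times> 'a \<Rightarrow> real)"
    by (auto simp: bilinear_def graph_form_def inner_add intro!: linearI)
  show "graph_form x y = graph_form y x" if "x \<in> S" "y \<in> S" for x y
    using sym_S[of "fst x" "snd x" "fst y" "snd y"] that by (simp add: graph_form_def inner_commute)
  show "0 \<le> graph_form x x" if "x \<in> S" for x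
    using pos_S[of "fst x" "snd x"] that \<epsilon> by (simp add: graph_form_def) (meson mult_nonneg_nonneg order_less_imp_le order_trans zero_le_power2)
qed

lemma form_Cauchy_imp_Cauchy_fst:
  assumes s: "\<And>n. s n \<in> S" "form_Cauchy graph_form s"
  shows "Cauchy (\<lambda>n. fst (s n))"
  unfolding Cauchy_iff_norm_power2
proof (rule tendsto_sandwich[OF _ _ tendsto_const])
  show "((\<lambda>p. (case p of (n, m) \<Rightarrow> graph_form (s n - s m) (s n - s m)) / \<epsilon>) \<longlongrightarrow> 0)
      (sequentially \<times>\<^sub>F sequentially)"
    using tendsto_divide[OF s(2)[unfolded form_Cauchy_def] tendsto_const[of \<epsilon>]] \<epsilon> by simp
  have "\<epsilon> * (norm (fst (s n) - fst (s m)))\<^sup>2 \<le> graph_form (s n - s m) (s n - s m)" for n m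
    using pos_S[of "fst (s n - s m)" "snd (s n - s m)"] subspace_diff[OF subspace_S s(1)[of n] s(1)[of m]]
    by (simp add: graph_form_def flip: fst_diff snd_diff)
  then show "\<forall>\<^sub>F p in sequentially \<times>\<^sub>F sequentially.
      (case p of (n, m) \<Rightarrow> (norm (fst (s n) - fst (s m)))\<^sup>2)
      \<le> (case p of (n, m) \<Rightarrow> graph_form (s n - s m) (s n - s m)) / \<epsilon>"
    using \<epsilon> by (intro always_eventually allI) (auto simp: field_simps)
qed (auto intro: always_eventually)

text \<open>The counterpart of \<open>form_approx\<close> on the graph: the images under S travel
  with the sequence.\<close>

definition form_limit :: "(nat \<Rightarrow> 'a \<times> 'a) \<Rightarrow> 'a \<Rightarrow> bool" where
  "form_limit s f \<longleftrightarrow> (\<forall>n. s n \<in> S) \<and> form_Cauchy graph_form s \<and> (\<lambda>n. fst (s n)) \<longlonglongrightarrow> f"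

lemma form_limit_bounded:
  assumes "form_limit s f"
  obtains K where "K > 0" "\<forall>\<^sub>F n in sequentially. graph_form (s n) (s n) \<le> K"
proof -
  have s: "\<And>n. s n \<in> S" "form_Cauchy graph_form s" using assms by (auto simp: form_limit_def)
  obtain N where "\<forall>n\<ge>N. \<forall>m\<ge>N. \<bar>graph_form (s n - s m) (s n - s m)\<bar> < 1"
    using s(2) unfolding form_Cauchy_def tendsto_prod_sequentially_zero_iff
    by (meson zero_less_one)
  then have N: "graph_form (s n - s N) (s n - s N) < 1" if "n \<ge> N" for n using that by force
  have "graph_form (s n) (s n) \<le> 2 + 2 * graph_form (s N) (s N)" if "n \<ge> N" for n
  proof -
    \<comment> \<open>For the quadratic form q, q(x - 2 y) = 2 q(x - y) + 2 q(y) - q(x), which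
      bounds q(x).\<close>
    have "0 \<le> graph_form (s n - 2 *\<^sub>R s N) (s n - 2 *\<^sub>R s N)"
      using s(1) by (intro nonneg subspace_diff subspace_scale subspace_S) auto
    then show ?thesis
      using N[OF that] sym[OF s(1)[of n] s(1)[of N]] unfolding form_simps real_scaleR_def right_diff_distrib by linarith
  qed
  then have "\<forall>\<^sub>F n in sequentially. graph_form (s n) (s n) \<le> 2 + 2 * graph_form (s N) (s N)"
    by (rule eventually_sequentiallyI)
  moreover have "0 < 2 + 2 * graph_form (s N) (s N)" using nonneg[OF s(1)[of N]] by simp
  ultimately show thesis by (rule that[rotated])
qed

text \<open>This is closability in usable form. With the second argument fixed, the pairing
  converges because S^* f = x; Cauchy-Schwarz and the boundedness of the form along
  \<open>s'\<close> make this uniform, so the diagonal converges too.\<close>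

lemma form_limit_pairing:
  assumes s: "form_limit s f" and fx: "(f, x) \<in> radj S" and s': "form_limit s' f'"
  shows "(\<lambda>n. graph_form (s n) (s' n)) \<longlonglongrightarrow> inner x f'"
proof -
  have sS: "s n \<in> S" "s' n \<in> S" for n using s s' by (auto simp: form_limit_def)
  obtain K where K: "K > 0" "\<forall>\<^sub>F n in sequentially. graph_form (s' n) (s' n) \<le> K"
    using form_limit_bounded[OF s'] by blast
  have lim: "(\<lambda>k. graph_form (s k) (s' n)) \<longlonglongrightarrow> inner x (fst (s' n))" for n
  proof -
    have "inner f (snd (s' n)) = inner x (fst (s' n))"
      using radjD[OF fx, of "fst (s' n)" "snd (s' n)"] sS by simp
    moreover have "(\<lambda>k. inner (fst (s k)) (snd (s' n))) \<longlonglongrightarrow> inner f (snd (s' n))"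
      using s by (intro tendsto_inner tendsto_const) (simp add: form_limit_def)
    ultimately show ?thesis by (simp add: graph_form_def)
  qed
  have "(\<lambda>n. graph_form (s n) (s' n) - inner x (fst (s' n))) \<longlonglongrightarrow> 0"
    unfolding tendsto_iff
  proof safe
    fix e :: real assume e: "e > 0"
    \<comment> \<open>Chosen so that multiplication by the bound K in Cauchy-Schwarz yields (e /
      2)^2.\<close>
    have "e\<^sup>2 / (4 * K) > 0" using e K by simp
    then obtain N where N: "\<forall>n\<ge>N. \<forall>m\<ge>N. \<bar>graph_form (s n - s m) (s n - s m)\<bar> < e\<^sup>2 / (4 * K)"
      using s unfolding form_limit_def form_Cauchy_def tendsto_prod_sequentially_zero_iff by meson
    have "\<bar>graph_form (s n) (s' n) - inner x (fst (s' n))\<bar> < e"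
      if n: "n \<ge> N" "graph_form (s' n) (s' n) \<le> K" for n
    proof -
      have "\<bar>graph_form (s n) (s' n) - graph_form (s k) (s' n)\<bar> \<le> e / 2" if "k \<ge> N" for k
      proof -
        have "(graph_form (s n - s k) (s' n))\<^sup>2
            \<le> graph_form (s n - s k) (s n - s k) * graph_form (s' n) (s' n)"
          using sS by (intro cauchy_schwarz subspace_diff subspace_S) auto
        also have "\<dots> \<le> e\<^sup>2 / (4 * K) * K"
          using N that n sS nonneg K by (intro mult_mono) (auto simp: abs_less_iff less_imp_le)
        also have "\<dots> = (e / 2)\<^sup>2" using K by (simp add: power2_eq_square)
        finally have "\<bar>graph_form (s n - s k) (s' n)\<bar> \<le> e / 2"
          using e by (simp add: abs_le_square_iff[symmetric])
        then show ?thesis by (simp add: form_simps)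
      qed
      then have "\<bar>graph_form (s n) (s' n) - inner x (fst (s' n))\<bar> \<le> e / 2"
        by (intro LIMSEQ_le_const2[OF tendsto_rabs[OF tendsto_diff[OF tendsto_const lim]]]) blast
      then show ?thesis using e by simp
    qed
    then show "\<forall>\<^sub>F n in sequentially. dist (graph_form (s n) (s' n) - inner x (fst (s' n))) 0 < e"
      using eventually_conj[OF eventually_ge_at_top[of N] K(2)]
      by (auto simp: dist_real_def elim: eventually_mono)
  qed
  moreover have "(\<lambda>n. inner x (fst (s' n))) \<longlonglongrightarrow> inner x f'"
    using s' by (auto simp: form_limit_def intro!: tendsto_intros)
  ultimately have "(\<lambda>n. graph_form (s n) (s' n) - inner x (fst (s' n)) + inner x (fst (s' n)))
      \<longlonglongrightarrow> 0 + inner x f'" by (rule tendsto_add)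
  then show ?thesis by simp
qed

text \<open>The classical description of S_F: the adjoint of S restricted to the form
  domain.\<close>

definition friedrichs_graph :: "('a \<times> 'a) set" where
  "friedrichs_graph = {(f, x). (f, x) \<in> radj S \<and> (\<exists>s. form_limit s f)}"

lemma S_subset_friedrichs: "S \<subseteq> friedrichs_graph"
proof
  fix p assume p: "p \<in> S"
  then have "form_limit (\<lambda>_. p) (fst p)"
    by (auto simp: form_limit_def form_Cauchy_def graph_form_def case_prod_beta')
  moreover have "p \<in> radj S"
    using sym_S[of "fst p" "snd p"] p radjI[of S "fst p" "snd p"] by simp
  ultimately show "p \<in> friedrichs_graph"
    unfolding friedrichs_graph_def by (cases p) auto
qed

lemma friedrichs_sym:
  assumes "(f, g) \<in> friedrichs_graph" "(u, v) \<in> friedrichs_graph"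
  shows "inner f v = inner g u"
proof -
  obtain s s' where s: "(f, g) \<in> radj S" "form_limit s f" "(u, v) \<in> radj S" "form_limit s' u"
    using assms by (auto simp: friedrichs_graph_def)
  have "graph_form (s' n) (s n) = graph_form (s n) (s' n)" for n
    using s(2,4) by (intro sym) (auto simp: form_limit_def)
  with form_limit_pairing[OF s(4,3,2)] have "(\<lambda>n. graph_form (s n) (s' n)) \<longlonglongrightarrow> inner v f"
    by (simp only:)
  from LIMSEQ_unique[OF this form_limit_pairing[OF s(2,1,4)]] show ?thesis
    by (simp add: inner_commute)
qed

lemma friedrichs_pos:
  assumes "(f, g) \<in> friedrichs_graph"
  shows "\<epsilon> * (norm f)\<^sup>2 \<le> inner f g"
proof -
  obtain s where s: "(f, g) \<in> radj S" "form_limit s f"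
    using assms by (auto simp: friedrichs_graph_def)
  have "(\<lambda>n. \<epsilon> * (norm (fst (s n)))\<^sup>2) \<longlonglongrightarrow> \<epsilon> * (norm f)\<^sup>2"
    using s(2) by (auto simp: form_limit_def intro!: tendsto_intros)
  moreover have "\<epsilon> * (norm (fst (s n)))\<^sup>2 \<le> graph_form (s n) (s n)" for n
    using pos_S[of "fst (s n)" "snd (s n)"] s(2) by (simp add: form_limit_def graph_form_def)
  ultimately have "\<epsilon> * (norm f)\<^sup>2 \<le> inner g f"
    using LIMSEQ_le[OF _ form_limit_pairing[OF s(2,1,2)]] by blast
  then show ?thesis by (simp add: inner_commute)
qed

text \<open>The functional <x, .> is bounded for the form, with constant (norm x)^2 / \<epsilon> by
  strict positivity. Its minimizing sequence is also Cauchy in norm, and the limit f satisfies S^* f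
  = x.\<close>

lemma friedrichs_surj: "\<exists>f. (f, x) \<in> friedrichs_graph"
proof -
  have "linear (\<lambda>p. inner x (fst p))" by (auto intro!: linearI simp: inner_add)
  moreover have "(inner x (fst p))\<^sup>2 \<le> (norm x)\<^sup>2 / \<epsilon> * graph_form p p" if "p \<in> S" for p
  proof -
    have "(inner x (fst p))\<^sup>2 \<le> (norm x)\<^sup>2 * (norm (fst p))\<^sup>2"
      using Cauchy_Schwarz_ineq[of x "fst p"] by (simp add: power2_norm_eq_inner)
    also have "\<dots> \<le> (norm x)\<^sup>2 * (graph_form p p / \<epsilon>)"
      using pos_S[of "fst p" "snd p"] that \<epsilon>
      by (intro mult_left_mono) (simp_all add: graph_form_def field_simps)
    finally show ?thesis by simp
  qed
  ultimately obtain s where s: "\<And>n. s n \<in> S" "form_Cauchy graph_form s"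
      "\<And>p. p \<in> S \<Longrightarrow> (\<lambda>n. graph_form (s n) p) \<longlonglongrightarrow> inner x (fst p)"
    using riesz_minimizing_sequence[of "\<lambda>p. inner x (fst p)" "(norm x)\<^sup>2 / \<epsilon>"] \<epsilon>
    by (metis divide_nonneg_pos zero_le_power2)
  obtain f where f: "(\<lambda>n. fst (s n)) \<longlonglongrightarrow> f"
    using form_Cauchy_imp_Cauchy_fst[OF s(1,2)] Cauchy_convergent convergent_def by blast
  have "(f, x) \<in> radj S"
  proof (rule radjI)
    fix u v assume "(u, v) \<in> S"
    then have "(\<lambda>n. inner (fst (s n)) v) \<longlonglongrightarrow> inner x u" using s(3)[of "(u, v)"] by (simp add: graph_form_def)
    moreover have "(\<lambda>n. inner (fst (s n)) v) \<longlonglongrightarrow> inner f v" by (intro tendsto_intros f)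
    ultimately show "inner f v = inner x u" using LIMSEQ_unique by blast
  qed
  moreover have "form_limit s f" using s f by (simp add: form_limit_def)
  ultimately show ?thesis by (auto simp: friedrichs_graph_def)
qed

lemma nonneg_sa_friedrichs: "nonneg_sa friedrichs_graph"
  unfolding nonneg_sa_def
proof (intro conjI)
  show "single_valued friedrichs_graph"
  proof (rule single_valuedI)
    fix f g g' assume g: "(f, g) \<in> friedrichs_graph" "(f, g') \<in> friedrichs_graph"
    have "inner (g - g') u = 0" if "u \<in> Domain S" for u
      using that S_subset_friedrichs friedrichs_sym[OF g(1)] friedrichs_sym[OF g(2)]
      by (force simp: inner_diff_left)
    then show "g = g'" using dense_S[of "g - g'"] by simp
  qed
  show "radj friedrichs_graph = friedrichs_graph"
    using friedrichs_sym friedrichs_surj by (rule radj_eqI_surj)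
  show "\<forall>(f, g)\<in>friedrichs_graph. 0 \<le> inner f g"
  proof clarify
    fix f g assume "(f, g) \<in> friedrichs_graph"
    then have "\<epsilon> * (norm f)\<^sup>2 \<le> inner f g" by (rule friedrichs_pos)
    moreover have "0 \<le> \<epsilon> * (norm f)\<^sup>2" using \<epsilon> by simp
    ultimately show "0 \<le> inner f g" by linarith
  qed
qed

end

section \<open>The square root B of the Friedrichs extension and the operator L\<close>

locale friedrichs_root = strictly_positive_graph S \<epsilon> for S :: "('a::{real_inner,banach} \<times> 'a) set" and \<epsilon> +
  fixes B :: "('a \<times> 'a) set"
  assumes B: "nonneg_sa B" and BB: "B O B = friedrichs_graph"
begin

lemmas sub_B = nonneg_saD(3)[OF B] and closed_B = nonneg_saD(4)[OF B]
  and sv_B = single_valuedD[OF nonneg_saD(1)[OF B]] and sym_B = nonneg_saD(6)[OF B]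
  and radj_B = nonneg_saD(2)[OF B]

lemma S_factor:
  assumes "(u, v) \<in> S" obtains k where "(u, k) \<in> B" "(k, v) \<in> B"
  using assms S_subset_friedrichs BB by blast

lemma B_inner_eq:
  assumes "p \<in> S" "(fst p, k) \<in> B"
  shows "inner k k = graph_form p p"
proof -
  obtain u v where p: "p = (u, v)" by (cases p)
  obtain k' where "(u, k') \<in> B" "(k', v) \<in> B" using S_factor assms(1) p by blast
  then show ?thesis using sv_B[of u k k'] assms(2) sym_B[of u k k v] by (simp add: p graph_form_def)
qed

text \<open>The last factor of the surjective product B B = S_F is onto.\<close>

lemma B_surj: "\<exists>f. (f, h) \<in> B"
  using friedrichs_surj[of h] BB by blast

lemma Cauchy_iff_form_Cauchy:
  assumes "\<And>n. s n \<in> S" "\<And>n. (fst (s n), k n) \<in> B"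
  shows "Cauchy k \<longleftrightarrow> form_Cauchy graph_form s"
proof -
  have "(norm (k n - k m))\<^sup>2 = graph_form (s n - s m) (s n - s m)" for n m
    using B_inner_eq[of "s n - s m" "k n - k m"] subspace_diff[OF subspace_S] assms
      subspace_prod_diff[OF sub_B assms(2)[of n] assms(2)[of m]]
    by (simp add: power2_norm_eq_inner)
  then show ?thesis unfolding Cauchy_iff_norm_power2 form_Cauchy_def by simp
qed

lemma form_limit_B:
  assumes "form_limit s f"
  obtains k h where "\<And>n. (fst (s n), k n) \<in> B" "k \<longlonglongrightarrow> h" "(f, h) \<in> B"
proof -
  have s: "\<And>n. s n \<in> S" "form_Cauchy graph_form s" "(\<lambda>n. fst (s n)) \<longlonglongrightarrow> f"
    using assms by (auto simp: form_limit_def)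
  have "\<exists>k. (fst (s n), k) \<in> B" for n
    using S_factor[of "fst (s n)" "snd (s n)"] s(1)[of n] by auto
  then obtain k where k: "\<And>n. (fst (s n), k n) \<in> B" by metis
  have "Cauchy k" using Cauchy_iff_form_Cauchy[of s k, OF s(1) k] s(2) by simp
  then obtain h where "k \<longlonglongrightarrow> h" using Cauchy_convergent convergent_def by blast
  then show thesis using that k closed_prod_limit[OF closed_B k s(3)] by blast
qed

text \<open>As B is selfadjoint with square S_F, the domain of S_F is a core of B. Its elements are
  form limits from D(S), and form convergence is convergence in the graph of B.\<close>

lemma B_core:
  assumes "p \<in> B"
  shows "p \<in> closure {(f, h). (f, h) \<in> B \<and> f \<in> Domain S}" (is "_ \<in> closure ?N")
proof -
  have "p \<in> closure {(f, h). (f, h) \<in> B \<and> f \<in> Domain friedrichs_graph}"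
    using von_Neumann_core[OF sub_B closed_B nonneg_saD(1)[OF B] assms] by (simp add: radj_B BB)
  moreover have "{(f, h). (f, h) \<in> B \<and> f \<in> Domain friedrichs_graph} \<subseteq> closure ?N"
  proof clarify
    fix f h g assume "(f, h) \<in> B" "(f, g) \<in> friedrichs_graph"
    then obtain s where s: "form_limit s f" by (auto simp: friedrichs_graph_def)
    obtain k h' where k: "\<And>n. (fst (s n), k n) \<in> B" "k \<longlonglongrightarrow> h'" "(f, h') \<in> B"
      using form_limit_B[OF s] by blast
    have "h' = h" using sv_B k(3) \<open>(f, h) \<in> B\<close> by blast
    have "fst (s n) \<in> Domain S" for n
      using s by (auto simp: form_limit_def intro: DomainI[of _ "snd (s n)"])
    then have "\<forall>n. (fst (s n), k n) \<in> ?N" using k(1) by blast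
    moreover have "(\<lambda>n. (fst (s n), k n)) \<longlonglongrightarrow> (f, h)"
      using s k(2) \<open>h' = h\<close> by (auto simp: form_limit_def intro: tendsto_Pair)
    ultimately show "(f, h) \<in> closure ?N"
      unfolding closure_sequential by (intro exI[of _ "\<lambda>n. (fst (s n), k n)"] conjI)
  qed
  ultimately show ?thesis by (meson closed_closure closure_minimal subsetD)
qed

text \<open>On D(S) the form is the squared norm of B u, so form limits and limits in the graph of B
  correspond; the core property supplies sequences from D(S).\<close>

lemma Domain_B: "Domain B = {f. \<exists>s. form_limit s f}"
proof safe
  fix f h assume "(f, h) \<in> B"
  then obtain p where p: "\<And>n. p n \<in> {(f, h). (f, h) \<in> B \<and> f \<in> Domain S}" "p \<longlonglongrightarrow> (f, h)"
    using B_core unfolding closure_sequential by blast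
  have pB: "(fst (p n), snd (p n)) \<in> B" "fst (p n) \<in> Domain S" for n
    using p(1)[of n] by (auto split: prod.splits)
  have "\<forall>n. \<exists>v. (fst (p n), v) \<in> S" using pB(2) by blast
  then obtain v where v: "\<And>n. (fst (p n), v n) \<in> S" by metis
  define s where "s n = (fst (p n), v n)" for n
  have "Cauchy (\<lambda>n. snd (p n))" using tendsto_snd[OF p(2)] by (simp add: LIMSEQ_imp_Cauchy)
  then have "form_Cauchy graph_form s"
    using Cauchy_iff_form_Cauchy[of s "\<lambda>n. snd (p n)"] v pB by (simp add: s_def)
  then have "form_limit s f"
    using v tendsto_fst[OF p(2)] by (simp add: form_limit_def s_def)
  then show "\<exists>s. form_limit s f" by blast
next
  fix f s assume "form_limit s f"
  then show "f \<in> Domain B" using form_limit_B by blast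
qed

lemma graph_form_limit:
  assumes "form_limit s f" "(f, h) \<in> B"
  shows "(\<lambda>n. graph_form (s n) (s n)) \<longlonglongrightarrow> (norm h)\<^sup>2"
proof -
  obtain k h' where k: "\<And>n. (fst (s n), k n) \<in> B" "k \<longlonglongrightarrow> h'" "(f, h') \<in> B"
    using form_limit_B[OF assms(1)] by blast
  have "h' = h" using sv_B k(3) assms(2) by blast
  have "graph_form (s n) (s n) = (norm (k n))\<^sup>2" for n
    using B_inner_eq[OF _ k(1)] assms(1) by (simp add: form_limit_def power2_norm_eq_inner)
  then show ?thesis using tendsto_power[OF tendsto_norm[OF k(2)]] \<open>h' = h\<close> by simp
qed

text \<open>This operator maps $u + v$ to $B u$ for $u$ in the domain of $B$ and $v$ in the kernel of the
  adjoint of $S$. It is not selfadjoint, but $S_K$ is its square in the sense of von Neumann's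
  theorem, so it has the same domain as the root of $S_K$.\<close>

definition krein_root :: "('a \<times> 'a) set" where
  "krein_root = radj (B\<inverse> O S)"

text \<open>By linearity two cases suffice: B itself lies in the adjoint, and at second component 0
  the condition only sees the range of S, because every element of D(S) has an image under
  B.\<close>

lemma krein_root_eq:
  "(f, h) \<in> krein_root \<longleftrightarrow> (\<exists>u v. f = u + v \<and> (u, h) \<in> B \<and> (v, 0) \<in> radj S)"
proof
  have sub: "subspace krein_root" by (simp add: krein_root_def subspace_radj)
  have B_sub: "(u, h) \<in> krein_root" if "(u, h) \<in> B" for u h
    unfolding krein_root_def
  proof (rule radjI)
    fix k v assume "(k, v) \<in> B\<inverse> O S"
    then obtain u' where u': "(u', k) \<in> B" "(u', v) \<in> S" by blast
    then have "(k, v) \<in> B" using S_factor sv_B by metis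
    then show "inner u v = inner h k" using sym_B that by blast
  qed
  have N_iff: "(v, 0) \<in> krein_root \<longleftrightarrow> (v, 0) \<in> radj S" for v
  proof
    assume v: "(v, 0) \<in> krein_root"
    show "(v, 0) \<in> radj S"
    proof (rule radjI)
      fix a b assume "(a, b) \<in> S"
      then obtain k where "(k, b) \<in> B\<inverse> O S" using S_factor by blast
      then show "inner v b = inner 0 a" using radjD[OF v[unfolded krein_root_def]] by fastforce
    qed
  qed (auto simp: krein_root_def radj_def)
  {
    assume f: "(f, h) \<in> krein_root"
    obtain u where u: "(u, h) \<in> B" using B_surj by blast
    have "(f - u, 0) \<in> krein_root" using subspace_prod_diff[OF sub f B_sub[OF u]] by simp
    then show "\<exists>u v. f = u + v \<and> (u, h) \<in> B \<and> (v, 0) \<in> radj S"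
      using u N_iff by (intro exI[of _ u] exI[of _ "f - u"]) simp
  next
    assume "\<exists>u v. f = u + v \<and> (u, h) \<in> B \<and> (v, 0) \<in> radj S"
    then show "(f, h) \<in> krein_root"
      using subspace_prod_add[OF sub B_sub] N_iff by fastforce
  }
qed

text \<open>The difference d of two values is orthogonal to B(D(S)). As d = B u for some u and D(S)
  is a core of B, d is a limit of vectors in that set.\<close>

lemma single_valued_krein_root: "single_valued krein_root"
proof (rule single_valuedI)
  have sub: "subspace krein_root" by (simp add: krein_root_def subspace_radj)
  fix f h h' assume "(f, h) \<in> krein_root" "(f, h') \<in> krein_root"
  then have d: "(0, h - h') \<in> krein_root" using subspace_prod_diff[OF sub] by fastforce
  obtain u where "(u, h - h') \<in> B" using B_surj by blast
  have *: "inner (h - h') k = 0" if ak: "(a, k) \<in> B" "a \<in> Domain S" for a k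
  proof -
    obtain b where "(a, b) \<in> S" using ak(2) by blast
    then have "(k, b) \<in> B\<inverse> O S" using ak(1) by blast
    then show ?thesis using radjD[OF d[unfolded krein_root_def]] by fastforce
  qed
  obtain p where p: "\<And>n. p n \<in> {(f, h). (f, h) \<in> B \<and> f \<in> Domain S}" "p \<longlonglongrightarrow> (u, h - h')"
    using B_core[OF \<open>(u, h - h') \<in> B\<close>] unfolding closure_sequential by blast
  have "inner (h - h') (snd (p n)) = 0" for n
    using p(1)[of n] * by (auto split: prod.splits)
  moreover have "(\<lambda>n. inner (h - h') (snd (p n))) \<longlonglongrightarrow> inner (h - h') (h - h')"
    using tendsto_snd[OF p(2)] by (intro tendsto_intros) simp
  ultimately have "inner (h - h') (h - h') = 0" by (simp add: LIMSEQ_const_iff)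
  then show "h = h'" by simp
qed

text \<open>On such an f the single-valued \<open>krein_root\<close> takes both values B f and 0. So
  B f = 0, S_F f = 0, and strict positivity applies.\<close>

lemma Domain_B_Int_kernel:
  assumes "f \<in> Domain B" "(f, 0) \<in> radj S"
  shows "f = 0"
proof -
  obtain h where "(f, h) \<in> B" using assms(1) by blast
  moreover have "(f, h) \<in> krein_root" using \<open>(f, h) \<in> B\<close> subspace_prod_0[OF subspace_radj[of S]]
    unfolding krein_root_eq by (intro exI[of _ f] exI[of _ 0]) simp
  moreover have "(f, 0) \<in> krein_root"
    using assms(2) subspace_prod_0[OF sub_B] unfolding krein_root_eq by (intro exI[of _ 0] exI[of _ f]) simp
  ultimately have "(f, 0) \<in> B" using single_valuedD[OF single_valued_krein_root] by blast
  then have "(f, 0) \<in> friedrichs_graph" using subspace_prod_0[OF sub_B] BB by blast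
  then have "\<epsilon> * (norm f)\<^sup>2 \<le> 0" using friedrichs_pos by fastforce
  then show ?thesis using \<epsilon> by (simp add: mult_le_0_iff)
qed

lemma Domain_S_subset: "Domain S \<subseteq> Domain krein_root"
proof clarify
  fix a b assume "(a, b) \<in> S"
  then obtain k where "(a, k) \<in> B" using S_factor by blast
  then have "(a, k) \<in> krein_root"
    using subspace_prod_0[OF subspace_radj[of S]]
    unfolding krein_root_eq by (intro exI[of _ a] exI[of _ 0]) simp
  then show "a \<in> Domain krein_root" by blast
qed

lemma nonneg_sa_krein: "nonneg_sa (krein_root O radj krein_root)"
proof (rule nonneg_sa_von_Neumann)
  show "subspace krein_root" "closed krein_root"
    by (simp_all add: krein_root_def subspace_radj closed_radj)
  show "w = 0" if "\<And>u. u \<in> Domain krein_root \<Longrightarrow> inner w u = 0" for w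
    using that Domain_S_subset by (intro dense_S) blast
qed (rule single_valued_krein_root)

lemma closure_S_subset: "closure S \<subseteq> friedrichs_graph"
  using S_subset_friedrichs nonneg_saD(4)[OF nonneg_sa_friedrichs] by (rule closure_minimal)

text \<open>The orthogonal complement of ker S^* is the closure of ran S. The estimate \<epsilon> *
  norm f \<le> norm (S f) makes preimages of a convergent sequence of images converge as
  well.\<close>

lemma closure_S_surj:
  assumes "\<And>v. (v, 0) \<in> radj S \<Longrightarrow> inner g v = 0"
  obtains u where "(u, g) \<in> closure S"
proof -
  have ran: "g \<in> closure (snd ` S)"
  proof (rule mem_closure_if_double_orthogonal)
    show "subspace (snd ` S)" using subspace_S by (intro linear_subspace_image linear_snd)
    fix y assume "\<And>m. m \<in> snd ` S \<Longrightarrow> inner m y = 0"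
    then have "(y, 0) \<in> radj S" by (intro radjI) (force simp: inner_commute)
    then show "inner g y = 0" by (rule assms)
  qed
  then obtain x where x: "\<And>n. x n \<in> snd ` S" "x \<longlonglongrightarrow> g" unfolding closure_sequential by blast
  then have "\<forall>n. \<exists>p. p \<in> S \<and> x n = snd p" by blast
  then obtain s where s: "\<And>n. s n \<in> S" "\<And>n. x n = snd (s n)" by metis
  have le: "\<epsilon> * norm (fst (s n) - fst (s m)) \<le> norm (x n - x m)" for n m
  proof -
    have "s n - s m \<in> S" using s(1) subspace_S by (simp add: subspace_diff)
    then have "\<epsilon> * (norm (fst (s n - s m)))\<^sup>2 \<le> inner (fst (s n - s m)) (snd (s n - s m))"
      by (intro pos_S) (simp del: fst_diff snd_diff)
    also have "\<dots> \<le> norm (fst (s n - s m)) * norm (snd (s n - s m))" by (rule norm_cauchy_schwarz)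
    finally have "norm (fst (s n - s m)) * (\<epsilon> * norm (fst (s n - s m))) \<le> norm (fst (s n - s m)) * norm (snd (s n - s m))"
      by (simp add: power2_eq_square algebra_simps)
    then show ?thesis by (cases "fst (s n - s m) = 0") (auto simp: s(2))
  qed
  have "Cauchy (\<lambda>n. fst (s n))"
  proof (rule CauchyI)
    fix e :: real assume "e > 0"
    then have "\<epsilon> * e > 0" using \<epsilon> by simp
    then obtain M where "\<forall>m\<ge>M. \<forall>n\<ge>M. norm (x m - x n) < \<epsilon> * e"
      using LIMSEQ_imp_Cauchy[OF x(2)] unfolding Cauchy_iff by blast
    then show "\<exists>M. \<forall>m\<ge>M. \<forall>n\<ge>M. norm (fst (s m) - fst (s n)) < e"
      using le \<epsilon> by (meson mult_less_cancel_left_pos order_le_less_trans)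
  qed
  then obtain u where "(\<lambda>n. fst (s n)) \<longlonglongrightarrow> u" using Cauchy_convergent convergent_def by blast
  then have "(\<lambda>n. (fst (s n), x n)) \<longlonglongrightarrow> (u, g)" using x(2) by (rule tendsto_Pair)
  then have "s \<longlonglongrightarrow> (u, g)" by (simp add: s(2))
  then show thesis using that s(1) unfolding closure_sequential by blast
qed

text \<open>Testing g = L^* h on the two summands of D(L) separates the conditions: (h, g) lies in
  B, and g is orthogonal to ker S^*. For h = B u the first says S_F u = g, the second that g is in
  the range of \<open>closure S\<close>.\<close>

lemma krein_root_square:
  "krein_root O radj krein_root = {(u + v, g) | u v g. (u, g) \<in> closure S \<and> (v, 0) \<in> radj S}"
proof safe
  fix f h g assume "(f, h) \<in> krein_root" and hg: "(h, g) \<in> radj krein_root"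
  then obtain u v where uv: "f = u + v" "(u, h) \<in> B" "(v, 0) \<in> radj S" by (auto simp: krein_root_eq)
  have sub0: "(0, 0) \<in> B" "(0, 0) \<in> radj S"
    using subspace_prod_0 sub_B subspace_radj by blast+
  have "(h, g) \<in> radj B"
  proof (rule radjI)
    fix a b assume "(a, b) \<in> B"
    then have "(a, b) \<in> krein_root" unfolding krein_root_eq using sub0 by (intro exI[of _ a] exI[of _ 0]) simp
    then show "inner h b = inner g a" by (rule radjD[OF hg])
  qed
  then have ug: "(u, g) \<in> friedrichs_graph" using uv(2) BB by (auto simp: radj_B)
  have "inner g w = 0" if "(w, 0) \<in> radj S" for w
  proof -
    have "(w, 0) \<in> krein_root" unfolding krein_root_eq using sub0 that by (intro exI[of _ 0] exI[of _ w]) simp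
    then show ?thesis using radjD[OF hg] by fastforce
  qed
  then obtain u' where u': "(u', g) \<in> closure S" using closure_S_surj by blast
  \<comment> \<open>\<open>closure S\<close> is contained in S_F, so u' and u have the same image
    under S_F, which is injective.\<close>
  then have "(u' - u, 0) \<in> friedrichs_graph"
    using ug closure_S_subset subspace_prod_diff[OF nonneg_saD(3)[OF nonneg_sa_friedrichs]] by fastforce
  then have "\<epsilon> * (norm (u' - u))\<^sup>2 \<le> 0" using friedrichs_pos by fastforce
  then have "u' = u" using \<epsilon> by (simp add: mult_le_0_iff)
  then show "\<exists>u v g'. (f, g) = (u + v, g') \<and> (u, g') \<in> closure S \<and> (v, 0) \<in> radj S"
    using uv u' by blast
next
  fix u v g assume ug: "(u, g) \<in> closure S" and v: "(v, 0) \<in> radj S"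
  obtain h where h: "(u, h) \<in> B" "(h, g) \<in> B" using ug closure_S_subset BB by blast
  have "(u + v, h) \<in> krein_root" using h v by (auto simp: krein_root_eq)
  moreover have "(h, g) \<in> radj krein_root"
  proof (rule radjI)
    fix a b assume "(a, b) \<in> krein_root"
    then obtain c w where cw: "a = c + w" "(c, b) \<in> B" "(w, 0) \<in> radj S" by (auto simp: krein_root_eq)
    obtain s where s: "\<And>n. s n \<in> S" "s \<longlonglongrightarrow> (u, g)" using ug unfolding closure_sequential by blast
    have "inner w (snd (s n)) = 0" for n
      using radjD[OF cw(3), of "fst (s n)" "snd (s n)"] s(1) by simp
    moreover have "(\<lambda>n. inner w (snd (s n))) \<longlonglongrightarrow> inner w g"
      using tendsto_snd[OF s(2)] by (intro tendsto_intros) simp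
    ultimately have "inner w g = 0" by (simp add: LIMSEQ_const_iff)
    then show "inner h b = inner g a"
      using sym_B[OF h(2) cw(2)] by (simp add: cw(1) inner_right_distrib inner_commute)
  qed
  ultimately show "(u + v, g) \<in> krein_root O radj krein_root" by blast
qed

end

section \<open>Complex structure\<close>

lemma scaleC_ii: "\<i> *\<^sub>C \<i> *\<^sub>C x = - x"
  using scaleC_of_real[of "-1" x] by (simp add: scaleC_scaleC)

lemma scaleC_expand: "c *\<^sub>C x = Re c *\<^sub>R x + Im c *\<^sub>R (\<i> *\<^sub>C x)"
proof -
  have "c *\<^sub>C x = (of_real (Re c) + of_real (Im c) * \<i>) *\<^sub>C x"
    by (metis complex_eq mult.commute)
  then show ?thesis
    by (simp add: scaleC_add_left scaleC_of_real flip: scaleC_scaleC)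
qed

lemma Im_cinner: "Im (cinner x y) = - inner x (\<i> *\<^sub>C y)"
  by (simp add: cinner_scaleC_right flip: Re_cinner)

lemma inner_scaleC_i_left: "inner (\<i> *\<^sub>C x) y = - inner x (\<i> *\<^sub>C y)"
proof -
  have "inner (\<i> *\<^sub>C x) y = Re (cnj (cinner y (\<i> *\<^sub>C x)))"
    by (metis Re_cinner cinner_commute)
  also have "\<dots> = - Im (cinner y x)" by (simp add: cinner_scaleC_right)
  also have "\<dots> = Im (cinner x y)" by (subst cinner_commute) simp
  finally show ?thesis by (simp add: Im_cinner)
qed

lemma inner_scaleC_i: "inner (\<i> *\<^sub>C x) (\<i> *\<^sub>C y) = inner x y"
  by (simp add: inner_scaleC_i_left scaleC_ii)

lemma bounded_linear_scaleC_i: "bounded_linear (\<lambda>x :: 'a::chilbert_space. \<i> *\<^sub>C x)"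
proof (rule bounded_linear_intro)
  show "\<i> *\<^sub>C r *\<^sub>R x = r *\<^sub>R \<i> *\<^sub>C x" for r and x :: 'a
    by (metis mult.commute scaleC_of_real scaleC_scaleC)
  show "norm (\<i> *\<^sub>C x) \<le> norm x * 1" for x :: 'a
    by (simp add: norm_eq_sqrt_inner inner_scaleC_i)
qed (rule scaleC_add_right)

text \<open>For graphs invariant under multiplication by \<open>\<i>\<close>, adjoints and selfadjointness may be
  computed with the real inner product alone.\<close>

definition i_invariant :: "'a::chilbert_space op \<Rightarrow> bool" where
  "i_invariant T \<longleftrightarrow> (\<forall>(f, g)\<in>T. (\<i> *\<^sub>C f, \<i> *\<^sub>C g) \<in> T)"

lemma i_invariantD: "i_invariant T \<Longrightarrow> (f, g) \<in> T \<Longrightarrow> (\<i> *\<^sub>C f, \<i> *\<^sub>C g) \<in> T"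
  by (auto simp: i_invariant_def)

lemma linear_op_iff: "linear_op T \<longleftrightarrow> subspace T \<and> single_valued T \<and> i_invariant T"
proof
  assume T: "linear_op T"
  then have add: "(f + f', g + g') \<in> T" if "(f, g) \<in> T" "(f', g') \<in> T" for f g f' g'
    using that unfolding linear_op_def by blast
  have scale: "(r *\<^sub>R f, r *\<^sub>R g) \<in> T" if "(f, g) \<in> T" for r f g
    using T that unfolding linear_op_def scaleC_of_real[symmetric] by blast
  have "subspace T"
    using T add scale by (auto simp: subspace_def linear_op_def zero_prod_def)
  then show "subspace T \<and> single_valued T \<and> i_invariant T"
    using T by (auto simp: linear_op_def i_invariant_def)
next
  assume T: "subspace T \<and> single_valued T \<and> i_invariant T"
  have "(c *\<^sub>C f, c *\<^sub>C g) \<in> T" if "(f, g) \<in> T" for c f g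
    unfolding scaleC_expand[of c] using T that
    by (intro subspace_prod_add subspace_prod_scale i_invariantD) auto
  then show "linear_op T"
    using T subspace_prod_0 subspace_prod_add unfolding linear_op_def by blast
qed

text \<open>Testing the real identity on (i u, i v) as well recovers the imaginary part.\<close>

lemma adj_eq_radj:
  assumes "i_invariant T"
  shows "adj T = radj T"
proof safe
  fix f h assume "(f, h) \<in> adj T"
  then show "(f, h) \<in> radj T" by (auto simp: adj_def radj_def simp flip: Re_cinner)
next
  fix f h assume fh: "(f, h) \<in> radj T"
  have "cinner f v = cinner h u" if "(u, v) \<in> T" for u v
    using radjD[OF fh that] radjD[OF fh i_invariantD[OF assms that]]
    by (simp add: complex_eq_iff Re_cinner Im_cinner)
  then show "(f, h) \<in> adj T" by (auto simp: adj_def)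
qed

lemma i_invariant_radj:
  assumes "i_invariant T"
  shows "i_invariant (radj T)"
  unfolding i_invariant_def
proof (intro ballI, clarify, rule radjI)
  fix f h u v assume "(f, h) \<in> radj T" "(u, v) \<in> T"
  then show "inner (\<i> *\<^sub>C f) v = inner (\<i> *\<^sub>C h) u"
    using radjD i_invariantD[OF assms] by (fastforce simp: inner_scaleC_i_left)
qed

lemma i_invariant_relcomp: "i_invariant T \<Longrightarrow> i_invariant U \<Longrightarrow> i_invariant (T O U)"
  unfolding i_invariant_def by blast

lemma i_invariant_converse: "i_invariant T \<Longrightarrow> i_invariant (T\<inverse>)"
  unfolding i_invariant_def by blast

lemma single_valued_radj_dense: "single_valued (radj T) \<Longrightarrow> (\<And>u. u \<in> Domain T \<Longrightarrow> inner w u = 0) \<Longrightarrow> w = 0"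
  using single_valuedD[of "radj T" 0 w 0] by (auto simp: radj_def)

text \<open>The bridge between the complex definitions and the real theory. Density of the domain
  comes from single-valuedness of \<open>radj T\<close>, which is T: a vector w orthogonal to the
  domain gives (0, w) in it.\<close>

lemma selfadjoint_nonnegative_iff:
  "selfadjoint T \<and> nonnegative T \<longleftrightarrow> i_invariant T \<and> nonneg_sa T"
proof
  assume "selfadjoint T \<and> nonnegative T"
  then show "i_invariant T \<and> nonneg_sa T"
    using adj_eq_radj[of T]
    by (auto simp: selfadjoint_def nonnegative_def nonneg_sa_def linear_op_iff Re_cinner)
next
  assume T: "i_invariant T \<and> nonneg_sa T"
  have "closure (Domain T) = UNIV"
  proof -
    have "x \<in> closure (Domain T)" for x
    proof (rule mem_closure_if_double_orthogonal)
      have "subspace (fst ` T)" using T nonneg_saD(3) by (intro linear_subspace_image linear_fst) auto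
      then show "subspace (Domain T)" by (simp add: Domain_fst)
      fix y assume "\<And>m. m \<in> Domain T \<Longrightarrow> inner m y = 0"
      then show "inner x y = 0"
        using single_valued_radj_dense[of T y] T by (simp add: nonneg_sa_def inner_commute)
    qed
    then show ?thesis by blast
  qed
  then show "selfadjoint T \<and> nonnegative T"
    using T adj_eq_radj[of T] nonneg_saD(3)[of T]
    by (auto simp: selfadjoint_def nonnegative_def nonneg_sa_def linear_op_iff densely_defined_def Re_cinner)
qed

section \<open>Resolving the definite descriptions of roots and form operators\<close>

lemma op_sqrt_eqI:
  assumes "nonneg_sa T" "i_invariant B" "nonneg_sa B" "B O B = T"
  shows "op_sqrt T = B"
  unfolding op_sqrt_def
proof (rule the_equality)
  show "selfadjoint B \<and> nonnegative B \<and> B O B = T"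
    using selfadjoint_nonnegative_iff assms by blast
  show "C = B" if "selfadjoint C \<and> nonnegative C \<and> C O C = T" for C
    using that selfadjoint_nonnegative_iff[of C] nonneg_sa_sqrt_unique[OF assms(1) _ _ assms(3,4), of C] by simp
qed

text \<open>The real root inherits every bounded symmetry of T; multiplication by i, packaged as the
  bounded operator \<open>J\<close>, is one of them, so the root is complex linear.\<close>

lemma op_sqrt:
  assumes "nonneg_sa T" "i_invariant T"
  shows "nonneg_sa (op_sqrt T)" "i_invariant (op_sqrt T)" "op_sqrt T O op_sqrt T = T"
proof -
  define J where "J = Blinfun (\<lambda>x :: 'a. \<i> *\<^sub>C x)"
  have J: "blinfun_apply J = (\<lambda>x. \<i> *\<^sub>C x)"
    unfolding J_def by (rule bounded_linear_Blinfun_apply[OF bounded_linear_scaleC_i])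
  obtain B where B: "nonneg_sa B" "B O B = T"
    "\<forall>Z :: 'a \<Rightarrow>\<^sub>L 'a. (\<forall>(f, g)\<in>T. (Z f, Z g) \<in> T) \<longrightarrow> (\<forall>(f, g)\<in>B. (Z f, Z g) \<in> B)"
    using nonneg_sa_sqrt_exists[OF assms(1)] by blast
  have "i_invariant B"
    using B(3)[rule_format, of J] assms(2) by (auto simp: J i_invariant_def)
  moreover from this have "op_sqrt T = B" using op_sqrt_eqI[OF assms(1)] B by blast
  ultimately show "nonneg_sa (op_sqrt T)" "i_invariant (op_sqrt T)" "op_sqrt T O op_sqrt T = T"
    using B by simp_all
qed

lemma app_eq: "single_valued T \<Longrightarrow> (f, g) \<in> T \<Longrightarrow> app T f = g"
  unfolding app_def by (auto intro: the_equality dest: single_valuedD)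

text \<open>Polarization gives <B' f, B' u> = <B f, B u>. If B f is in D(B), this equals <g, u> for
  all u in the common domain, so B' f is in the domain of the adjoint of B', which is B'.\<close>

lemma form_representation_subset:
  assumes B: "nonneg_sa B" and B': "nonneg_sa B'" and Dom: "Domain B = Domain B'"
    and norm: "\<And>f h h'. (f, h) \<in> B \<Longrightarrow> (f, h') \<in> B' \<Longrightarrow> norm h = norm h'"
  shows "B O B \<subseteq> B' O B'"
proof clarify
  fix f h g assume h: "(f, h) \<in> B" "(h, g) \<in> B"
  have "f \<in> Domain B'" using h(1) Dom by blast
  then obtain h' where h': "(f, h') \<in> B'" by blast
  have "(h', g) \<in> radj B'"
  proof (rule radjI)
    fix u k' assume k': "(u, k') \<in> B'"
    then have "u \<in> Domain B" using Dom by blast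
    then obtain k where k: "(u, k) \<in> B" by blast
    have "norm (h + k) = norm (h' + k')"
      using norm subspace_prod_add[OF nonneg_saD(3)[OF B] h(1) k] subspace_prod_add[OF nonneg_saD(3)[OF B'] h' k'] by blast
    then have "inner (h + k) (h + k) = inner (h' + k') (h' + k')" by (simp flip: power2_norm_eq_inner)
    moreover have "inner h h = inner h' h'" "inner k k = inner k' k'"
      using norm[OF h(1) h'] norm[OF k k'] by (simp_all flip: power2_norm_eq_inner)
    ultimately have "inner h' k' = inner h k" by (simp add: inner_add inner_commute)
    also have "\<dots> = inner g u" using nonneg_saD(6)[OF B h(2) k] .
    finally show "inner h' k' = inner g u" .
  qed
  then show "(f, g) \<in> B' O B'" using h' nonneg_saD(2)[OF B'] by auto
qed

lemma form_op_eqI: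
  assumes F: "nonneg_sa F" "i_invariant F"
    and Dom: "Domain (op_sqrt F) = D"
    and q: "\<And>f h. (f, h) \<in> op_sqrt F \<Longrightarrow> q f = (norm h)\<^sup>2"
  shows "form_op D q = F"
proof -
  have app_norm: "(\<forall>f\<in>Domain (op_sqrt V). (norm (app (op_sqrt V) f))\<^sup>2 = q f) \<longleftrightarrow>
      (\<forall>(f, h)\<in>op_sqrt V. q f = (norm h)\<^sup>2)" if "nonneg_sa V" "i_invariant V" for V :: "'a op"
  proof -
    have app: "app (op_sqrt V) f = h" if "(f, h) \<in> op_sqrt V" for f h
      using app_eq[OF nonneg_saD(1)[OF op_sqrt(1)[OF \<open>nonneg_sa V\<close> \<open>i_invariant V\<close>]] that] .
    show ?thesis
    proof
      assume *: "\<forall>f\<in>Domain (op_sqrt V). (norm (app (op_sqrt V) f))\<^sup>2 = q f"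
      show "\<forall>(f, h)\<in>op_sqrt V. q f = (norm h)\<^sup>2"
      proof clarify
        fix f h assume fh: "(f, h) \<in> op_sqrt V"
        then have "f \<in> Domain (op_sqrt V)" by (rule DomainI)
        then have "(norm (app (op_sqrt V) f))\<^sup>2 = q f" using * by (rule bspec[rotated])
        then show "q f = (norm h)\<^sup>2" by (simp add: app[OF fh])
      qed
    next
      assume *: "\<forall>(f, h)\<in>op_sqrt V. q f = (norm h)\<^sup>2"
      show "\<forall>f\<in>Domain (op_sqrt V). (norm (app (op_sqrt V) f))\<^sup>2 = q f"
      proof clarify
        fix f h assume fh: "(f, h) \<in> op_sqrt V"
        then show "(norm (app (op_sqrt V) f))\<^sup>2 = q f" using bspec[OF * fh] by (simp add: app[OF fh])
      qed
    qed
  qed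
  have "V = F" if V: "nonneg_sa V" "i_invariant V" "Domain (op_sqrt V) = D"
      "\<forall>(f, h)\<in>op_sqrt V. q f = (norm h)\<^sup>2" for V
  proof -
    have *: "norm h = norm h'" if "(f, h) \<in> op_sqrt V" "(f, h') \<in> op_sqrt F" for f h h'
      using V(4) q[OF that(2)] that(1) by fastforce
    have "op_sqrt V O op_sqrt V \<subseteq> op_sqrt F O op_sqrt F"
      using * V Dom by (intro form_representation_subset op_sqrt F) auto
    moreover have "op_sqrt F O op_sqrt F \<subseteq> op_sqrt V O op_sqrt V"
      using *[symmetric] V Dom by (intro form_representation_subset op_sqrt F) auto
    ultimately show ?thesis using op_sqrt(3)[OF F] op_sqrt(3)[OF V(1,2)] by simp
  qed
  note unique = this
  show ?thesis
    unfolding form_op_def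
  proof (rule the_equality)
    show "selfadjoint F \<and> nonnegative F \<and> Domain (op_sqrt F) = D \<and>
        (\<forall>f\<in>D. (norm (app (op_sqrt F) f))\<^sup>2 = q f)"
      using selfadjoint_nonnegative_iff[of F] F Dom app_norm[OF F] q by auto
    show "V = F" if V: "selfadjoint V \<and> nonnegative V \<and> Domain (op_sqrt V) = D \<and>
        (\<forall>f\<in>D. (norm (app (op_sqrt V) f))\<^sup>2 = q f)" for V
    proof -
      have V': "nonneg_sa V" "i_invariant V" using V selfadjoint_nonnegative_iff[of V] by blast+
      then show ?thesis using V app_norm[OF V'] by (intro unique) auto
    qed
  qed
qed

lemma symmetric_strictly_positive_graph:
  assumes S: "symmetric_op S" "strictly_positive S"
  obtains \<epsilon> where "strictly_positive_graph S \<epsilon>"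
proof -
  obtain \<epsilon> where \<epsilon>: "\<epsilon> > 0" "\<And>f g. (f, g) \<in> S \<Longrightarrow> \<epsilon> * (norm f)\<^sup>2 \<le> inner f g"
    using S(2) by (auto simp: strictly_positive_def Re_cinner)
  have lin: "subspace S" "i_invariant S"
    using S(1) by (auto simp: symmetric_op_def linear_op_iff)
  have "strictly_positive_graph S \<epsilon>"
  proof
    show "inner f v = inner g u" if "(f, g) \<in> S" "(u, v) \<in> S" for f g u v
      using that S(1) adj_eq_radj[OF lin(2)] radjD[of f g S u v] by (auto simp: symmetric_op_def)
    show "w = 0" if w: "\<And>u. u \<in> Domain S \<Longrightarrow> inner w u = 0" for w
    proof -
      have "w \<in> closure (Domain S)" using S(1) by (simp add: symmetric_op_def densely_defined_def)
      then obtain x where x: "\<And>n. x n \<in> Domain S" "x \<longlonglongrightarrow> w" unfolding closure_sequential by blast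
      have "(\<lambda>n. inner w (x n)) \<longlonglongrightarrow> inner w w" by (intro tendsto_intros x)
      then have "inner w w = 0" using w[OF x(1)] by (simp add: LIMSEQ_const_iff)
      then show ?thesis by simp
    qed
  qed (use lin \<epsilon> in auto)
  then show thesis by (rule that)
qed

lemma i_invariant_friedrichs_graph:
  assumes "strictly_positive_graph S \<epsilon>" "i_invariant S"
  shows "i_invariant (strictly_positive_graph.friedrichs_graph S)"
proof -
  interpret strictly_positive_graph S \<epsilon> by fact
  show ?thesis
    unfolding i_invariant_def friedrichs_graph_def
  proof clarsimp
    fix f x s assume fx: "(f, x) \<in> radj S" and s: "form_limit s f"
    define t where "t n = (\<i> *\<^sub>C fst (s n), \<i> *\<^sub>C snd (s n))" for n
    have lim: "(\<lambda>n. \<i> *\<^sub>C fst (s n)) \<longlonglongrightarrow> \<i> *\<^sub>C f"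
      using s by (intro bounded_linear.tendsto[OF bounded_linear_scaleC_i]) (simp add: form_limit_def)
    have "graph_form (t n - t m) (t n - t m) = graph_form (s n - s m) (s n - s m)" for n m
      by (simp add: graph_form_def t_def inner_scaleC_i
          flip: linear_diff[OF bounded_linear.linear[OF bounded_linear_scaleC_i]])
    moreover have "t n \<in> S" for n
      using s i_invariantD[OF assms(2), of "fst (s n)" "snd (s n)"] by (simp add: t_def form_limit_def)
    ultimately have "form_limit t (\<i> *\<^sub>C f)"
      using s lim by (simp add: form_limit_def form_Cauchy_def t_def)
    then show "(\<i> *\<^sub>C f, \<i> *\<^sub>C x) \<in> radj S \<and> (\<exists>s. form_limit s (\<i> *\<^sub>C f))"
      using i_invariantD[OF i_invariant_radj[OF assms(2)] fx] by blast
  qed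
qed

section \<open>Identification of S_F, V_A, W_A and S_K\<close>

locale friedrichs_form = friedrichs_root S \<epsilon> B for S :: "'a::chilbert_space op" and \<epsilon> B +
  assumes i_invariant_S: "i_invariant S" and i_invariant_B: "i_invariant B"
begin

lemma op_sqrt_friedrichs: "op_sqrt friedrichs_graph = B"
  by (rule op_sqrt_eqI[OF nonneg_sa_friedrichs i_invariant_B B BB])

lemma form_approx_iff:
  assumes q: "\<And>f g. (f, g) \<in> S \<Longrightarrow> q f = inner f g"
  shows "form_approx (Domain S) q f s \<longleftrightarrow> form_limit (\<lambda>n. (s n, app S (s n))) f"
proof (cases "\<forall>n. s n \<in> Domain S")
  case True
  have S: "(s n, app S (s n)) \<in> S" for n
    using True app_eq[OF single_valued_S] by (metis DomainE)
  have "q (s n - s m) = graph_form ((s n, app S (s n)) - (s m, app S (s m)))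
      ((s n, app S (s n)) - (s m, app S (s m)))" for n m
    using q[OF subspace_prod_diff[OF subspace_S S[of n] S[of m]]] by (simp add: graph_form_def)
  moreover have "(\<lambda>n. norm (s n - f)) \<longlonglongrightarrow> 0 \<longleftrightarrow> s \<longlonglongrightarrow> f"
    by (simp only: tendsto_norm_zero_iff LIM_zero_iff)
  ultimately show ?thesis
    using True S by (simp add: form_approx_def form_limit_def form_Cauchy_def conj_commute)
next
  case False
  then show ?thesis by (auto simp: form_approx_def form_limit_def)
qed

lemma form_limit_app:
  assumes "form_limit t f"
  shows "t = (\<lambda>n. (fst (t n), app S (fst (t n))))"
proof
  fix n
  have "(fst (t n), snd (t n)) \<in> S" using assms by (simp add: form_limit_def)
  then show "t n = (fst (t n), app S (fst (t n)))" using app_eq[OF single_valued_S] by (metis prod.collapse)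
qed

lemma closure_form_dom_eq:
  assumes q: "\<And>f g. (f, g) \<in> S \<Longrightarrow> q f = inner f g"
  shows "closure_form_dom (Domain S) q = Domain B"
proof -
  have "(\<exists>s. form_approx (Domain S) q f s) \<longleftrightarrow> (\<exists>t. form_limit t f)" for f
  proof
    show "\<exists>t. form_limit t f" if "\<exists>s. form_approx (Domain S) q f s"
      using that form_approx_iff[of q f] q by blast
    show "\<exists>s. form_approx (Domain S) q f s" if ex: "\<exists>t. form_limit t f"
    proof -
      obtain t where t: "form_limit t f" using ex by blast
      then have "form_limit (\<lambda>n. (fst (t n), app S (fst (t n)))) f"
        using form_limit_app[OF t] by simp
      then have "form_approx (Domain S) q f (\<lambda>n. fst (t n))"
        using form_approx_iff[of q f "\<lambda>n. fst (t n)"] q by blast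
      then show ?thesis by blast
    qed
  qed
  then show ?thesis unfolding closure_form_dom_def Domain_B by simp
qed

lemma closure_form_eq:
  assumes q: "\<And>f g. (f, g) \<in> S \<Longrightarrow> q f = inner f g" and h: "(f, h) \<in> B"
  shows "closure_form (Domain S) q f = (norm h)\<^sup>2"
  unfolding closure_form_def
proof (rule the_equality)
  have lim: "(\<lambda>n. q (s n)) \<longlonglongrightarrow> (norm h)\<^sup>2" if "form_approx (Domain S) q f s" for s
  proof -
    define t where "t n = (s n, app S (s n))" for n
    have t: "form_limit t f" using that form_approx_iff[of q f s] q unfolding t_def by blast
    then have "q (s n) = graph_form (t n) (t n)" for n
      using q[of "s n" "app S (s n)"] by (simp add: form_limit_def t_def graph_form_def)
    then show ?thesis using graph_form_limit[OF t h] by simp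
  qed
  then show "\<forall>s. form_approx (Domain S) q f s \<longrightarrow> (\<lambda>n. q (s n)) \<longlonglongrightarrow> (norm h)\<^sup>2" by blast
  fix l assume l: "\<forall>s. form_approx (Domain S) q f s \<longrightarrow> (\<lambda>n. q (s n)) \<longlonglongrightarrow> l"
  \<comment> \<open>Without an approximating sequence every l would meet the description; f in D(B)
    guarantees one.\<close>
  have "f \<in> closure_form_dom (Domain S) q" using h closure_form_dom_eq[of q] q by blast
  then obtain s where "form_approx (Domain S) q f s" by (auto simp: closure_form_dom_def)
  then show "l = (norm h)\<^sup>2" using l lim LIMSEQ_unique by blast
qed

text \<open>Leaving \<open>q\<close> free off D(S) covers both Re <f, S f> and Im <f, i S f>, and
  thereby shows V_A = S_F.\<close>

lemma form_op_closure_form: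
  assumes q: "\<And>f g. (f, g) \<in> S \<Longrightarrow> q f = inner f g"
  shows "form_op (closure_form_dom (Domain S) q) (closure_form (Domain S) q) = friedrichs_graph"
proof (rule form_op_eqI)
  show "i_invariant friedrichs_graph"
    using i_invariant_friedrichs_graph[OF strictly_positive_graph_axioms i_invariant_S] .
qed (simp_all add: nonneg_sa_friedrichs op_sqrt_friedrichs closure_form_dom_eq[of q, OF q] closure_form_eq[of q, OF q])

lemma friedrichs_eq: "friedrichs S = friedrichs_graph"
  unfolding friedrichs_def Let_def
  by (rule form_op_closure_form) (simp add: app_eq[OF single_valued_S] Re_cinner)

lemma V_op_eq: "V_op (op_scale \<i> S) = friedrichs_graph"
proof -
  have sv: "single_valued (op_scale \<i> S)"
    by (rule single_valuedI) (auto simp: op_scale_def dest: single_valuedD[OF single_valued_S])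
  have Dom: "Domain (op_scale \<i> S) = Domain S" by (auto simp: op_scale_def)
  have "Im (cinner f (app (op_scale \<i> S) f)) = inner f g" if "(f, g) \<in> S" for f g
  proof -
    have "(f, \<i> *\<^sub>C g) \<in> op_scale \<i> S" using that by (auto simp: op_scale_def)
    then show ?thesis using app_eq[OF sv] by (simp add: cinner_scaleC_right Re_cinner)
  qed
  then show ?thesis unfolding V_op_def Let_def Dom by (rule form_op_closure_form)
qed

lemma W_op_eq: "W_op (op_scale \<i> S) = B\<inverse> O op_scale \<i> S"
  by (simp add: W_op_def V_op_eq op_sqrt_friedrichs)

lemma single_valued_radj_S: "single_valued (radj S)"
proof (rule single_valuedI)
  fix f g g' assume g: "(f, g) \<in> radj S" "(f, g') \<in> radj S"
  have "inner (g - g') u = 0" if "u \<in> Domain S" for u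
    using that radjD[OF g(1)] radjD[OF g(2)] by (auto simp: inner_diff_left)
  then show "g = g'" using dense_S[of "g - g'"] by simp
qed

lemma krein_von_neumann_eq: "krein_von_neumann S = krein_root O radj krein_root"
proof -
  have closure_sub: "closure S \<subseteq> radj S"
    using sym_S by (intro closure_minimal closed_radj) (auto intro: radjI)
  \<comment> \<open>The adjoint extends \<open>closure S\<close> and vanishes at v, so its value at
    u + v is that of \<open>closure S\<close> at u.\<close>
  have app: "app (radj S) (u + v) = g" if "(u, g) \<in> closure S" "(v, 0) \<in> radj S" for u v g
    using subspace_prod_add[OF subspace_radj, of u g S v 0] closure_sub that
    by (intro app_eq single_valued_radj_S) auto
  show ?thesis
    unfolding krein_root_square krein_von_neumann_def op_on_def ker_def adj_eq_radj[OF i_invariant_S]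
    using app by fastforce
qed

lemma i_invariant_krein_root: "i_invariant krein_root"
  unfolding krein_root_def
  by (intro i_invariant_radj i_invariant_relcomp i_invariant_converse i_invariant_S i_invariant_B)

text \<open>The selfadjoint root K satisfies K^* K = K^2 = S_K = L^* L, so the comparison of domains
  applies in both directions.\<close>

lemma Domain_op_sqrt_krein: "Domain (op_sqrt (krein_von_neumann S)) = Domain krein_root"
proof -
  define K where "K = op_sqrt (krein_von_neumann S)"
  have "i_invariant (krein_von_neumann S)"
    unfolding krein_von_neumann_eq by (intro i_invariant_relcomp i_invariant_radj i_invariant_krein_root)
  moreover have "nonneg_sa (krein_von_neumann S)"
    unfolding krein_von_neumann_eq by (rule nonneg_sa_krein)
  ultimately have K: "nonneg_sa K" "K O K = krein_von_neumann S"
    unfolding K_def using op_sqrt by blast+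
  have eq: "K O radj K = krein_root O radj krein_root"
    using K by (simp add: nonneg_saD(2) krein_von_neumann_eq)
  have root: "subspace krein_root" "closed krein_root"
    by (simp_all add: krein_root_def subspace_radj closed_radj)
  show ?thesis
    unfolding K_def[symmetric]
    using von_Neumann_Domain_subset[OF nonneg_saD(3,4,1)[OF K(1)] root single_valued_krein_root eq]
      von_Neumann_Domain_subset[OF root single_valued_krein_root nonneg_saD(3,4,1)[OF K(1)] eq[symmetric]]
    by blast
qed

text \<open>Complex linearity of B^-1 S allows each test pair to be replaced by its multiple by i,
  which moves the factor i of A = i S onto h. Hence i h = L f, the source of the factor -i.\<close>

lemma adj_W_iff: "(f, h) \<in> adj (W_op (op_scale \<i> S)) \<longleftrightarrow> (f, \<i> *\<^sub>C h) \<in> krein_root"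
proof -
  have W: "W_op (op_scale \<i> S) = {(k, \<i> *\<^sub>C v) | k v. (k, v) \<in> B\<inverse> O S}"
    unfolding W_op_eq unfolding op_scale_def by blast
  have inv: "i_invariant (B\<inverse> O S)"
    by (intro i_invariant_relcomp i_invariant_converse i_invariant_S i_invariant_B)
  then have "i_invariant (W_op (op_scale \<i> S))" unfolding W i_invariant_def by blast
  then have "(f, h) \<in> adj (W_op (op_scale \<i> S)) \<longleftrightarrow>
      (\<forall>(k, v)\<in>B\<inverse> O S. inner f (\<i> *\<^sub>C v) = inner h k)"
    unfolding adj_eq_radj[OF \<open>i_invariant (W_op (op_scale \<i> S))\<close>] unfolding W radj_def by blast
  also have "\<dots> \<longleftrightarrow> (\<forall>(k, v)\<in>B\<inverse> O S. inner f v = inner (\<i> *\<^sub>C h) k)"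
  proof safe
    fix k v u assume *: "\<forall>(k, v)\<in>B\<inverse> O S. inner f (\<i> *\<^sub>C v) = inner h k" and "(u, k) \<in> B" "(u, v) \<in> S"
    then have "(\<i> *\<^sub>C k, \<i> *\<^sub>C v) \<in> B\<inverse> O S" by (intro i_invariantD[OF inv]) blast
    then have "inner f (\<i> *\<^sub>C \<i> *\<^sub>C v) = inner h (\<i> *\<^sub>C k)" using * by blast
    then show "inner f v = inner (\<i> *\<^sub>C h) k" by (simp add: scaleC_ii inner_scaleC_i_left)
  next
    fix k v u assume *: "\<forall>(k, v)\<in>B\<inverse> O S. inner f v = inner (\<i> *\<^sub>C h) k" and "(u, k) \<in> B" "(u, v) \<in> S"
    then have "(\<i> *\<^sub>C k, \<i> *\<^sub>C v) \<in> B\<inverse> O S" by (intro i_invariantD[OF inv]) blast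
    then have "inner f (\<i> *\<^sub>C v) = inner (\<i> *\<^sub>C h) (\<i> *\<^sub>C k)" using * by blast
    then show "inner f (\<i> *\<^sub>C v) = inner h k" by (simp add: inner_scaleC_i)
  qed
  finally show ?thesis by (simp add: krein_root_def radj_def)
qed

lemma kernel_eq: "ker (adj S) = {v. (v, 0) \<in> radj S}"
  by (simp add: ker_def adj_eq_radj[OF i_invariant_S])

lemma Domain_krein_root: "Domain krein_root = {u + v | u v. u \<in> Domain B \<and> v \<in> ker (adj S)}"
proof safe
  fix f h assume "(f, h) \<in> krein_root"
  then show "\<exists>u v. f = u + v \<and> u \<in> Domain B \<and> v \<in> ker (adj S)"
    unfolding krein_root_eq kernel_eq by blast
next
  fix u v k assume "(u, k) \<in> B" "v \<in> ker (adj S)"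
  then have "(u + v, k) \<in> krein_root" unfolding krein_root_eq kernel_eq by blast
  then show "u + v \<in> Domain krein_root" by blast
qed

lemma direct_sum: "is_direct_sum (Domain krein_root) (Domain B) (ker (adj S))"
  unfolding is_direct_sum_def Domain_krein_root kernel_eq
  using Domain_B_Int_kernel subspace_prod_0[OF sub_B] subspace_prod_0[OF subspace_radj[of S]] by blast

lemma proj_along_eq:
  assumes "u \<in> Domain B" "v \<in> ker (adj S)"
  shows "proj_along (Domain B) (ker (adj S)) (u + v) = u"
  unfolding proj_along_def
proof (rule the_equality)
  fix w assume w: "w \<in> Domain B \<and> u + v - w \<in> ker (adj S)"
  obtain k where "(w - u, k) \<in> B"
    using w assms(1) subspace_prod_diff[OF sub_B] by blast
  moreover have "(w - u, 0) \<in> radj S"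
    using w assms(2) subspace_prod_diff[OF subspace_radj[of S], of v 0 "u + v - w" 0] by (simp add: kernel_eq)
  ultimately have "w - u = 0" using Domain_B_Int_kernel by blast
  then show "w = u" by simp
qed (use assms in simp)

lemma adj_W_eq:
  "adj (W_op (op_scale \<i> S)) = op_on (Domain krein_root)
     (\<lambda>f. (- \<i>) *\<^sub>C app B (proj_along (Domain B) (ker (adj S)) f))"
proof safe
  fix f h assume "(f, h) \<in> adj (W_op (op_scale \<i> S))"
  then obtain u v where uv: "f = u + v" "(u, \<i> *\<^sub>C h) \<in> B" "(v, 0) \<in> radj S"
    unfolding adj_W_iff krein_root_eq by blast
  have "proj_along (Domain B) (ker (adj S)) f = u"
    unfolding uv(1) using uv by (intro proj_along_eq) (auto simp: kernel_eq)
  then have "h = (- \<i>) *\<^sub>C app B (proj_along (Domain B) (ker (adj S)) f)"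
    using app_eq[OF nonneg_saD(1)[OF B] uv(2)] scaleC_of_real[of 1 h] by (simp add: scaleC_scaleC)
  moreover have "f \<in> Domain krein_root"
    using \<open>(f, h) \<in> adj (W_op (op_scale \<i> S))\<close> adj_W_iff by blast
  ultimately show "(f, h) \<in> op_on (Domain krein_root)
     (\<lambda>f. (- \<i>) *\<^sub>C app B (proj_along (Domain B) (ker (adj S)) f))"
    by (auto simp: op_on_def)
next
  fix f h assume "(f, h) \<in> op_on (Domain krein_root)
     (\<lambda>f. (- \<i>) *\<^sub>C app B (proj_along (Domain B) (ker (adj S)) f))"
  then have f: "f \<in> Domain krein_root"
    and h: "h = (- \<i>) *\<^sub>C app B (proj_along (Domain B) (ker (adj S)) f)" by (auto simp: op_on_def)
  obtain u v k where uv: "f = u + v" "(u, k) \<in> B" "(v, 0) \<in> radj S"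
    using f unfolding Domain_iff krein_root_eq by blast
  have "proj_along (Domain B) (ker (adj S)) f = u"
    unfolding uv(1) using uv by (intro proj_along_eq) (auto simp: kernel_eq)
  then have "\<i> *\<^sub>C h = k"
    using app_eq[OF nonneg_saD(1)[OF B] uv(2)] scaleC_of_real[of 1 k] by (simp add: h scaleC_scaleC)
  then show "(f, h) \<in> adj (W_op (op_scale \<i> S))"
    unfolding adj_W_iff krein_root_eq using uv by blast
qed

end

theorem lemma4p5:
  fixes S A S_F S_K W :: "'a::chilbert_space op" and P :: "'a \<Rightarrow> 'a"
  assumes "symmetric_op S" and "strictly_positive S"
    and "A = op_scale \<i> S"
    and "S_F = friedrichs S" and "S_K = krein_von_neumann S"
    and "W = W_op A"
    and "P = proj_along (Domain (op_sqrt S_F)) (ker (adj S))"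
  shows "Domain (adj W) = Domain (op_sqrt S_K) \<and>
    is_direct_sum (Domain (op_sqrt S_K)) (Domain (op_sqrt S_F)) (ker (adj S)) \<and>
    adj W = op_on (Domain (op_sqrt S_K)) (\<lambda>f. (- \<i>) *\<^sub>C app (op_sqrt S_F) (P f))"
proof -
  obtain \<epsilon> where "strictly_positive_graph S \<epsilon>"
    using symmetric_strictly_positive_graph[OF assms(1,2)] .
  then interpret strictly_positive_graph S \<epsilon> .
  have S: "i_invariant S" using assms(1) by (simp add: symmetric_op_def linear_op_iff)
  define B where "B = op_sqrt friedrichs_graph"
  interpret friedrichs_form S \<epsilon> B
    using op_sqrt[OF nonneg_sa_friedrichs i_invariant_friedrichs_graph[OF strictly_positive_graph_axioms S]] S
    by unfold_locales (simp_all add: B_def)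
  have "Domain (op_on D F) = D" for D and F :: "'a \<Rightarrow> 'a" by (auto simp: op_on_def)
  then show ?thesis
    unfolding assms(3-) friedrichs_eq op_sqrt_friedrichs Domain_op_sqrt_krein adj_W_eq
    using direct_sum by simp
qed

end
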